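(* (i) Pulling at $v_5$ yields the triangulation of $\nabla_{\mathrm{VI.c}}^{(4)}$ with $4$-dimensional cells $\langle0,1,2,3,5\rangle,\langle0,3,4,5,6\rangle,\langle0,1,3,5,6\rangle,\langle0,2,3,4,5\rangle$ and minimal non-faces $\{v_1,v_4\},\{v_2,v_6\}$. (ii) Pulling at $v_0$, $v_4$ and then at $v_7$ yields the triangulation of $\nabla_{\mathrm{VII.b}}^{(4)}$ with $4$-dimensional cells $\langle0,1,3,5,6\rangle,\langle0,3,4,5,6\rangle,\langle0,4,5,6,7\rangle,\langle0,1,5,6,7\rangle,\langle0,1,2,5,7\rangle,\langle0,2,4,5,7\rangle$ and minimal non-faces $\{v_2,v_6\},\{v_3,v_7\},\{v_1,v_4\},\{v_2,v_3\}$. (iii) Pulling at $v_0$, $v_2$ and then at $v_6$ yields the triangulation of $\nabla_{\mathrm{VIII.a}}^{(4)}$ with $4$-dimensional cells $\langle0,2,7,8,9\rangle,\langle0,2,5,7,9\rangle,\langle0,2,3,7,8\rangle,\langle0,1,2,3,7\rangle,\langle0,2,4,5,7\rangle,\langle0,1,2,4,7\rangle,\langle0,6,7,8,9\rangle,\langle0,3,6,7,8\rangle,\langle0,5,6,7,9\rangle,\langle0,4,5,6,7\rangle,\langle0,1,3,6,7\rangle,\langle0,1,4,6,7\rangle$ and minimal non-faces $\{v_1,v_5\},\{v_1,v_8\},\{v_1,v_9\},\{v_2,v_6\},\{v_3,v_4\},\{v_3,v_5\},\{v_3,v_9\},\{v_4,v_8\},\{v_4,v_9\},\{v_5,v_8\}$.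 (iv) Pulling at $v_0$, $v_1$ and then at $v_6$ yields the triangulation of $\nabla_{\mathrm{IX.a}}^{(4)}$ with $4$-dimensional cells $\langle0,2,5,7,9\rangle,\langle0,3,6,8,9\rangle,\langle0,1,4,7,8\rangle,\langle0,1,2,7,9\rangle,\langle0,1,7,8,9\rangle,\langle0,1,2,3,9\rangle,\langle0,1,3,8,9\rangle,\langle0,5,6,7,9\rangle,\langle0,6,7,8,9\rangle,\langle0,4,5,6,7\rangle,\langle0,4,6,7,8\rangle$ and minimal non-faces $\{v_4,v_9\},\{v_3,v_7\},\{v_1,v_6\},\{v_3,v_4\},\{v_3,v_5\},\{v_5,v_8\},\{v_2,v_8\},\{v_2,v_6\},\{v_1,v_5\},\{v_2,v_4\}$. (v) Pulling at $v_0$, $v_6$ and then at $v_3$ yields the triangulation of $\nabla_{\mathrm{X.a}}^{(4)}$ with $4$-dimensional cells $\langle0,1,4,5,8\rangle,\langle0,5,6,7,8\rangle,\langle0,4,5,6,8\rangle,\langle0,2,6,7,8\rangle,\langle0,3,5,7,8\rangle,\langle0,1,3,5,8\rangle,\langle0,2,3,7,8\rangle,\langle0,1,2,3,8\rangle$ and minimal non-faces $\{v_2,v_5\},\{v_3,v_4\},\{v_3,v_6\},\{v_1,v_7\},\{v_4,v_7\},\{v_1,v_6\},\{v_2,v_4\}$.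
   Context: The polytopes are the following subsets of $\mathbb{R}^4$ (coordinates $x,y,z,w$), with their lattice points written as coordinate strings $xyzw$: - $\nabla_{\mathrm{VI.c}}^{(4)}$: $x,y,z,w\ge0$, $x\le z+w\le1$, $w\le x+y\le1$; $v_0=0000$, $v_1=0010$, $v_2=1010$, $v_3=1001$, $v_4=0100$, $v_5=0110$, $v_6=0101$. - $\nabla_{\mathrm{VII.b}}^{(4)}$: $0\le x\le1$, $0\le y\le1$, $z,w\ge0$, $z+w\le1$, $z+w\le x+y\le1+z$; $v_0=0000$, $v_1=1000$, $v_2=0100$, $v_3=1010$, $v_4=0110$, $v_5=1110$, $v_6=1001$, $v_7=0101$. - $\nabla_{\mathrm{VIII.a}}^{(4)}$: $0\le x,y,z,w\le1$, $y\le z+w\le1+y$, $x\le z+w\le1+x$; $v_0=0000$, $v_1=0010$, $v_2=1010$, $v_3=0110$, $v_4=0001$, $v_5=1001$, $v_6=0101$, $v_7=1111$, $v_8=1110$, $v_9=1101$. - $\nabla_{\mathrm{IX.a}}^{(4)}$: $0\le x,y,z,w\le1$, $x+y\le z+w\le1+x+y$; $v_0=0000$, $v_1=0001$, $v_2=1001$, $v_3=0101$, $v_4=0010$, $v_5=1010$, $v_6=0110$, $v_7=1011$, $v_8=0111$, $v_9=1111$. - $\nabla_{\mathrm{X.a}}^{(4)}$: $0\le x,y,z\le1$, $w\ge0$, $x\le y+z$, $y+z+w\le1+x$; $v_0=0000$, $v_1=0100$, $v_2=0010$, $v_3=0001$, $v_4=1100$, $v_5=1101$, $v_6=1010$, $v_7=1011$,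 $v_8=1110$. Notation: $\langle i_1,\dots,i_k\rangle$ is the convex hull of $\{v_{i_1},\dots,v_{i_k}\}$. Pulling a subdivision at a lattice point $v$ replaces every cell $C$ containing $v$ by the cells $\mathrm{Conv}(\{v\}\cup F)$, $F$ ranging over the faces of $C$ not containing $v$, and keeps the cells not containing $v$; one starts from the trivial subdivision of the polytope. A non-face of a triangulation is a set of lattice points of the polytope contained in no face of the triangulation; it is a minimal non-face if all its proper subsets are contained in some face. *)

theory Defs
  imports "HOL-Analysis.Analysis"
begin

definition pt :: "real \<Rightarrow> real \<Rightarrow> real \<Rightarrow> real \<Rightarrow> real^4" where
  "pt x y z w = vector [x, y, z, w]"

definition lattice_points :: "(real^'n) set \<Rightarrow> (real^'n) set" where
  "lattice_points P = {p \<in> P. \<forall>i. p $ i \<in> \<int>}"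

text \<open>
  A polyhedral subdivision is represented by the set of all its cells, of every dimension.
  As for \<^term>\<open>(face_of)\<close>, the empty set counts as a face, so it is a cell of every
  subdivision below.  In \<open>pull\<close>, the face \<open>F = {}\<close> contributes the cell \<open>{v}\<close>.
\<close>

definition trivial_subdivision :: "'a::euclidean_space set \<Rightarrow> 'a set set" where
  "trivial_subdivision P = {F. F face_of P}"

definition pull :: "'a::euclidean_space \<Rightarrow> 'a set set \<Rightarrow> 'a set set" where
  "pull v S = {C \<in> S. v \<notin> C} \<union>
     {convex hull (insert v F) | C F. C \<in> S \<and> v \<in> C \<and> F face_of C \<and> v \<notin> F}"

definition pulling :: "'a::euclidean_space set \<Rightarrow> 'a list \<Rightarrow> 'a set set" where
  "pulling P vs = fold pull vs (trivial_subdivision P)"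

definition lattice_triangulation_of :: "(real^'n) set set \<Rightarrow> (real^'n) set \<Rightarrow> bool" where
  "lattice_triangulation_of T P \<longleftrightarrow> simplicial_complex T \<and> \<Union>T = P \<and>
     (\<forall>C \<in> T. \<forall>v. v extreme_point_of C \<longrightarrow> v \<in> lattice_points P)"

definition full_cells :: "(real^4) set set \<Rightarrow> (real^4) set set" where
  "full_cells T = {C \<in> T. aff_dim C = 4}"

definition non_face :: "(real^'n) set \<Rightarrow> (real^'n) set set \<Rightarrow> (real^'n) set \<Rightarrow> bool" where
  "non_face P T N \<longleftrightarrow> N \<subseteq> lattice_points P \<and> \<not> (\<exists>F \<in> T. N \<subseteq> F)"

definition minimal_non_faces :: "(real^'n) set \<Rightarrow> (real^'n) set set \<Rightarrow> (real^'n) set set" where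
  "minimal_non_faces P T = {N. non_face P T N \<and> (\<forall>M. M \<subset> N \<longrightarrow> (\<exists>F \<in> T. M \<subseteq> F))}"

definition cell :: "(nat \<Rightarrow> 'a::euclidean_space) \<Rightarrow> nat set \<Rightarrow> 'a set" where
  "cell v I = convex hull (v ` I)"

definition nabla_VIc :: "(real^4) set" where
  "nabla_VIc = {pt x y z w | x y z w.
     0 \<le> x \<and> 0 \<le> y \<and> 0 \<le> z \<and> 0 \<le> w \<and>
     x \<le> z + w \<and> z + w \<le> 1 \<and> w \<le> x + y \<and> x + y \<le> 1}"

definition v_VIc :: "nat \<Rightarrow> real^4" where
  "v_VIc i = [pt 0 0 0 0, pt 0 0 1 0, pt 1 0 1 0, pt 1 0 0 1,
                 pt 0 1 0 0, pt 0 1 1 0, pt 0 1 0 1] ! i"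

definition nabla_VIIb :: "(real^4) set" where
  "nabla_VIIb = {pt x y z w | x y z w.
     0 \<le> x \<and> x \<le> 1 \<and> 0 \<le> y \<and> y \<le> 1 \<and>
     0 \<le> z \<and> 0 \<le> w \<and> z + w \<le> 1 \<and> z + w \<le> x + y \<and>
     x + y \<le> 1 + z}"

definition v_VIIb :: "nat \<Rightarrow> real^4" where
  "v_VIIb i = [pt 0 0 0 0, pt 1 0 0 0, pt 0 1 0 0, pt 1 0 1 0,
                  pt 0 1 1 0, pt 1 1 1 0, pt 1 0 0 1, pt 0 1 0 1] ! i"

definition nabla_VIIIa :: "(real^4) set" where
  "nabla_VIIIa = {pt x y z w | x y z w.
     0 \<le> x \<and> x \<le> 1 \<and> 0 \<le> y \<and> y \<le> 1 \<and>
     0 \<le> z \<and> z \<le> 1 \<and> 0 \<le> w \<and> w \<le> 1 \<and>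
     y \<le> z + w \<and> z + w \<le> 1 + y \<and> x \<le> z + w \<and> z + w \<le> 1 + x}"

definition v_VIIIa :: "nat \<Rightarrow> real^4" where
  "v_VIIIa i = [pt 0 0 0 0, pt 0 0 1 0, pt 1 0 1 0, pt 0 1 1 0,
                   pt 0 0 0 1, pt 1 0 0 1, pt 0 1 0 1, pt 1 1 1 1,
                   pt 1 1 1 0, pt 1 1 0 1] ! i"

definition nabla_IXa :: "(real^4) set" where
  "nabla_IXa = {pt x y z w | x y z w.
     0 \<le> x \<and> x \<le> 1 \<and> 0 \<le> y \<and> y \<le> 1 \<and>
     0 \<le> z \<and> z \<le> 1 \<and> 0 \<le> w \<and> w \<le> 1 \<and>
     x + y \<le> z + w \<and> z + w \<le> 1 + x + y}"

definition v_IXa :: "nat \<Rightarrow> real^4" where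
  "v_IXa i = [pt 0 0 0 0, pt 0 0 0 1, pt 1 0 0 1, pt 0 1 0 1,
                 pt 0 0 1 0, pt 1 0 1 0, pt 0 1 1 0, pt 1 0 1 1,
                 pt 0 1 1 1, pt 1 1 1 1] ! i"

definition nabla_Xa :: "(real^4) set" where
  "nabla_Xa = {pt x y z w | x y z w.
     0 \<le> x \<and> x \<le> 1 \<and> 0 \<le> y \<and> y \<le> 1 \<and>
     0 \<le> z \<and> z \<le> 1 \<and> 0 \<le> w \<and> x \<le> y + z \<and>
     y + z + w \<le> 1 + x}"

definition v_Xa :: "nat \<Rightarrow> real^4" where
  "v_Xa i = [pt 0 0 0 0, pt 0 1 0 0, pt 0 0 1 0, pt 0 0 0 1,
                pt 1 1 0 0, pt 1 1 0 1, pt 1 0 1 0, pt 1 0 1 1,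
                pt 1 1 1 0] ! i"

end

theory Submission
  imports Defs
begin

text \<open>
  All five polytopes have vertices in \<open>{0, 1}\<^sup>4\<close>, and the proof turns each claim into a finite
  computation with subsets of the vertex set.

  Pulling is well behaved on the geometric side: if \<open>K\<close> is a polytopal complex, then so is
  \<open>pull v K\<close>, and it covers the same set (\<open>polytopal_complex_pull\<close>, \<open>Union_pull\<close>).  Every new cell is
  a pyramid over a face \<open>F\<close> of an old cell \<open>C\<close>; as \<open>F\<close> is a face, the apex lies outside the affine
  hull of \<open>F\<close>, so the faces of the pyramid are known, and a point of \<open>C\<close> is covered because the ray
  from the apex through it leaves \<open>C\<close> in a face that misses the apex.

  A set of 0/1 points is in convex position, even together with any further 0/1 points.  Hence a
  cell is determined by the set of indices of its vertices, inclusion and membership of vertices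
  can be read off from the index sets, and in a polytopal complex the relation ``is a face of'' is
  just inclusion.  So pulling becomes an operation on families of index sets (\<open>pull_cells\<close>).

  The starting family is the face lattice of the polytope.  For a bounded solution set of finitely
  many inequalities, a subset \<open>V\<close> spans it as soon as each of its points \<open>x\<close> admits a member of \<open>V\<close>
  that satisfies with equality every inequality that \<open>x\<close> satisfies with equality
  (\<open>solutions_eq_convex_hull\<close>), a statement of linear arithmetic; and its non-empty faces are spanned
  by the vertices lying on some of the bounding hyperplanes (\<open>face_of_solutions_iff\<close>).

  In each of the five cases the computed final family consists of all index sets that contain none
  of the listed pairs.  This one identity yields everything else (\<open>flag_triangulation\<close>).  The family
  is closed under subsets, and in such a complex the vertices of every cell are affinely
  independent: adding the vertices one at a time gives a chain of faces, and each new vertex avoids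
  the affine hull of the preceding face.  So all cells are simplices, the full-dimensional ones are
  those with five vertices, and the minimal non-faces are the listed pairs.
\<close>

section \<open>Pulling a polytopal complex\<close>

text \<open>
  In the last condition the roles of \<open>C\<close> and \<open>D\<close> can be exchanged, so the intersection is a face of
  both cells.
\<close>

definition polytopal_complex :: "'a::euclidean_space set set \<Rightarrow> bool" where
  "polytopal_complex K \<longleftrightarrow> finite K \<and> (\<forall>C\<in>K. polytope C) \<and>
     (\<forall>C\<in>K. \<forall>F. F face_of C \<longrightarrow> F \<in> K) \<and> (\<forall>C\<in>K. \<forall>D\<in>K. (C \<inter> D) face_of C)"

lemma polytopal_complexD:
  assumes "polytopal_complex K"
  shows "finite K" and "C \<in> K \<Longrightarrow> polytope C"
    and "C \<in> K \<Longrightarrow> F face_of C \<Longrightarrow> F \<in> K"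
    and "C \<in> K \<Longrightarrow> D \<in> K \<Longrightarrow> C \<inter> D face_of C"
proof -
  note K = assms[unfolded polytopal_complex_def]
  show "finite K" using K[THEN conjunct1] .
  show "C \<in> K \<Longrightarrow> polytope C" using K[THEN conjunct2, THEN conjunct1] by (rule bspec)
  show "C \<in> K \<Longrightarrow> F face_of C \<Longrightarrow> F \<in> K"
    using K[THEN conjunct2, THEN conjunct2, THEN conjunct1, rule_format, of C F] .
  show "C \<in> K \<Longrightarrow> D \<in> K \<Longrightarrow> C \<inter> D face_of C"
    using K[THEN conjunct2, THEN conjunct2, THEN conjunct2, rule_format, of C D] .
qed

lemma polytopal_complex_trivial_subdivision:
  assumes "polytope P"
  shows "polytopal_complex (trivial_subdivision P)"
  unfolding polytopal_complex_def trivial_subdivision_def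
proof (intro conjI ballI allI impI)
  show "finite {F. F face_of P}"
    by (rule finite_polytope_faces[OF assms])
next
  fix C D assume "C \<in> {F. F face_of P}" "D \<in> {F. F face_of P}"
  then have "C \<inter> D face_of P" and "C face_of P"
    by (auto intro: face_of_Int)
  then show "C \<inter> D face_of C"
    by (auto simp: face_of_face)
next
  show "polytope C" if "C \<in> {F. F face_of P}" for C
    using that face_of_polytope_polytope[OF assms] by simp
  show "F \<in> {F. F face_of P}" if "C \<in> {F. F face_of P}" "F face_of C" for C F
    using that(1) face_of_trans[OF that(2)] by simp
qed

lemma Union_trivial_subdivision:
  assumes "convex P"
  shows "\<Union>(trivial_subdivision P) = P"
proof
  show "\<Union>(trivial_subdivision P) \<subseteq> P"
    unfolding trivial_subdivision_def by (rule Union_least) (simp add: face_of_imp_subset)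
  show "P \<subseteq> \<Union>(trivial_subdivision P)"
    unfolding trivial_subdivision_def by (rule Union_upper) (simp add: face_of_refl[OF assms])
qed

lemma polytopal_complex_face_iff:
  assumes "polytopal_complex K" "C \<in> K" "D \<in> K"
  shows "C face_of D \<longleftrightarrow> C \<subseteq> D"
proof
  assume "C \<subseteq> D"
  then have "D \<inter> C = C" by blast
  then show "C face_of D" using polytopal_complexD(4)[OF assms(1,3,2)] by simp
qed (rule face_of_imp_subset)

lemma polytope_convex_hull_insert:
  assumes "polytope F"
  shows "polytope (convex hull insert v F)"
proof -
  obtain V where "finite V" "F = convex hull V"
    using assms polytope_def by blast
  then have "finite (insert v V)" "convex hull insert v F = convex hull insert v V"
    by (auto simp: hull_insert[symmetric])
  then show ?thesis using polytope_def by blast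
qed

text \<open>
  A face of a convex set is cut out of it by its own affine hull.  This makes every cell created by
  pulling a genuine pyramid, of one dimension more than its base.
\<close>

lemma apex_notin_affine_hull:
  fixes C :: "'a::euclidean_space set"
  assumes "convex C" "F face_of C" "v \<in> C" "v \<notin> F"
  shows "v \<notin> affine hull F"
proof
  assume "v \<in> affine hull F"
  then have "v \<in> affine hull F \<inter> C" using assms(3) by simp
  then show False
    using assms(4) by (simp flip: face_of_imp_eq_affine_Int[OF assms(1,2)])
qed

lemma face_of_pyramid_iff:
  fixes F :: "'a::euclidean_space set"
  assumes "polytope F" "v \<notin> affine hull F"
  shows "G face_of convex hull insert v F \<longleftrightarrow>
           G face_of F \<or> (\<exists>G'. G' face_of F \<and> G = convex hull insert v G')"
proof -
  obtain V where "finite V" and V: "F = convex hull V"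
    using assms(1) polytope_def by blast
  moreover have "v \<notin> affine hull V"
    using assms(2) by (simp add: V)
  moreover have "convex hull insert v F = convex hull insert v V"
    unfolding V by (rule hull_insert[symmetric])
  ultimately show ?thesis
    using face_of_convex_hull_insert_eq[of V v G] by (simp add: V)
qed

lemma pyramid_elim:
  assumes "p \<in> convex hull insert v F" "convex F" "p \<noteq> v"
  obtains u x where "0 < u" "u \<le> 1" "x \<in> F" "p = (1 - u) *\<^sub>R v + u *\<^sub>R x"
proof -
  have "F \<noteq> {}" using assms by auto
  then obtain x u where *: "p = (1 - u) *\<^sub>R v + u *\<^sub>R x" "0 \<le> u" "u \<le> 1" "x \<in> F"
    using assms(1,2) by (auto simp: convex_hull_insert_alt hull_same)
  then have "u \<noteq> 0" using assms(3) by auto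
  with * show thesis using that[of u x] by auto
qed

text \<open>
  A point of the pyramid strictly between \<open>v\<close> and the base cannot lie in \<open>D\<close>: it would be an inner
  point of a segment in \<open>C\<close>, and the face \<open>C \<inter> D\<close> of \<open>C\<close> would contain both ends, hence \<open>v\<close>.
\<close>

lemma pyramid_Int_cell:
  assumes F: "F face_of C" "convex C" "v \<in> C" "v \<notin> F"
    and CD: "C \<inter> D face_of C" and v: "v \<notin> D"
  shows "(convex hull insert v F) \<inter> D = F \<inter> D"
proof (intro equalityI subsetI)
  fix p assume p: "p \<in> (convex hull insert v F) \<inter> D"
  then have "p \<noteq> v" using v by auto
  then obtain u x where u: "0 < u" "u \<le> 1" "x \<in> F" "p = (1 - u) *\<^sub>R v + u *\<^sub>R x"
    using p pyramid_elim face_of_imp_convex[OF F(1)] by blast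
  have "x \<in> C" using u(3) face_of_imp_subset[OF F(1)] by auto
  show "p \<in> F \<inter> D"
  proof (cases "u = 1")
    case True then show ?thesis using u p by auto
  next
    case False
    then have "p \<in> open_segment v x"
      using u F(4) by (auto simp: in_segment)
    moreover have "p \<in> C"
      using u \<open>x \<in> C\<close> \<open>v \<in> C\<close> \<open>convex C\<close> by (simp add: convexD)
    ultimately have "v \<in> C \<inter> D"
      using face_ofD[OF CD, of p v x] p \<open>x \<in> C\<close> \<open>v \<in> C\<close> by auto
    then show ?thesis using v by auto
  qed
qed (auto intro: hull_inc)

text \<open>
  On a ray from \<open>v\<close>, a base in \<open>D\<close> cannot be met strictly before a base in a neighbouring cell \<open>C\<close>:
  the inner point \<open>y\<close> of the segment from \<open>v\<close> to \<open>x\<close> lies in the common face of \<open>C\<close> and \<open>D\<close>, which pulls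
  \<open>x\<close> into \<open>D\<close>, and then the face \<open>G\<close> of \<open>D\<close> would have to contain \<open>v\<close>.
\<close>

lemma face_seen_from_two_cells:
  assumes F: "F face_of C" "convex C" "v \<in> C"
    and G: "G face_of D" "v \<in> D" "v \<notin> G"
    and CD: "C \<inter> D face_of C"
    and x: "x \<in> F" and y: "y \<in> G" and yx: "y \<in> open_segment v x"
  shows False
proof -
  have "x \<in> C" using F x face_of_imp_subset by blast
  moreover have "y \<in> C"
    using yx \<open>x \<in> C\<close> F(2,3) convex_contains_open_segment by blast
  moreover have "y \<in> D" using G y face_of_imp_subset by blast
  ultimately have "x \<in> D"
    using face_ofD[OF CD yx] F(3) by auto
  then show False
    using face_ofD[OF G(1) yx G(2) _ y] G(3) by auto
qed

text \<open>
  By the preceding lemma, applied in both directions, a common point other than the apex is seen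
  from \<open>v\<close> in front of one and the same point of the two bases.
\<close>

lemma pyramid_Int_pyramid:
  assumes F: "F face_of C" "convex C" "v \<in> C" "v \<notin> F"
    and G: "G face_of D" "convex D" "v \<in> D" "v \<notin> G"
    and CD: "C \<inter> D face_of C" "C \<inter> D face_of D"
  shows "(convex hull insert v F) \<inter> (convex hull insert v G) = convex hull insert v (F \<inter> G)"
proof (intro equalityI subsetI)
  fix p assume p: "p \<in> (convex hull insert v F) \<inter> (convex hull insert v G)"
  show "p \<in> convex hull insert v (F \<inter> G)"
  proof (cases "p = v")
    case True then show ?thesis by (simp add: hull_inc)
  next
    case False
    obtain s x where x: "0 < s" "s \<le> 1" "x \<in> F" "p = (1 - s) *\<^sub>R v + s *\<^sub>R x"
      using p False pyramid_elim face_of_imp_convex[OF F(1)] by blast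
    obtain t y where y: "0 < t" "t \<le> 1" "y \<in> G" "p = (1 - t) *\<^sub>R v + t *\<^sub>R y"
      using p False pyramid_elim face_of_imp_convex[OF G(1)] by blast
    \<comment> \<open>of two points seen from \<open>v\<close> in the same direction, the one with the larger parameter is nearer\<close>
    have between: "b \<in> open_segment v a"
      if "(1 - s) *\<^sub>R v + s *\<^sub>R a = (1 - t) *\<^sub>R v + t *\<^sub>R b" "0 < s" "s < t" "a \<noteq> v"
      for a b :: 'a and s t :: real
    proof -
      have "t *\<^sub>R b = (t - s) *\<^sub>R v + s *\<^sub>R a"
        using that(1) by (simp add: algebra_simps)
      then have "(1 / t) *\<^sub>R (t *\<^sub>R b) = (1 / t) *\<^sub>R ((t - s) *\<^sub>R v + s *\<^sub>R a)" by simp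
      then have "b = (1 - s / t) *\<^sub>R v + (s / t) *\<^sub>R a"
        using that(2,3) by (simp add: scaleR_add_right diff_divide_distrib)
      then show ?thesis
        using that by (auto simp: in_segment intro!: exI[of _ "s / t"])
    qed
    have "\<not> s < t"
      using between[of s x t y] x y F face_seen_from_two_cells[OF F(1-3) G(1,3,4) CD(1)] by auto
    moreover have "\<not> t < s"
      using between[of t y s x] x y G(4) CD(2)
        face_seen_from_two_cells[OF G(1-3) F(1,3,4), of y x] by (auto simp: Int_commute)
    ultimately have "s = t" by simp
    then have "x = y" using x y by simp
    then have "x \<in> convex hull insert v (F \<inter> G)" "v \<in> convex hull insert v (F \<inter> G)"
      using x y by (auto intro: hull_inc)
    then show ?thesis
      using x(1,2,4) by (simp add: convexD)
  qed
next
  fix p assume "p \<in> convex hull insert v (F \<inter> G)"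
  then show "p \<in> (convex hull insert v F) \<inter> (convex hull insert v G)"
    using hull_mono[of "insert v (F \<inter> G)" "insert v F" convex]
      hull_mono[of "insert v (F \<inter> G)" "insert v G" convex] by auto
qed

text \<open>
  The ray from \<open>v\<close> through \<open>p\<close> leaves \<open>C\<close> at a last point \<open>q\<close>, and the smallest face containing \<open>q\<close>
  misses \<open>v\<close>: it contains \<open>q\<close> in its relative interior, so if it contained \<open>v\<close> as well, the ray could
  be prolonged beyond \<open>q\<close> inside it.  For \<open>p = v\<close> the empty face serves as the base.
\<close>

lemma polytope_covered_by_pyramids:
  fixes C :: "'a::euclidean_space set"
  assumes C: "polytope C" and v: "v \<in> C" and p: "p \<in> C"
  shows "\<exists>F. F face_of C \<and> v \<notin> F \<and> p \<in> convex hull insert v F"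
proof (cases "p = v")
  case True
  then show ?thesis by (intro exI[of _ "{}"]) auto
next
  case False
  define ray where "ray t = v + t *\<^sub>R (p - v)" for t
  let ?T = "{t. ray t \<in> C}"
  have "compact C" "convex C"
    using C by (auto simp: polytope_imp_compact polytope_imp_convex)
  have "closed ?T"
  proof -
    have "closed (ray -` C)"
      unfolding ray_def using \<open>compact C\<close>
      by (intro continuous_closed_vimage) (auto simp: compact_imp_closed)
    then show ?thesis by (simp add: vimage_def)
  qed
  obtain B where B: "\<forall>x\<in>C. norm x \<le> B"
    using compact_imp_bounded[OF \<open>compact C\<close>] unfolding bounded_iff ..
  have bound: "t \<le> (B + norm v) / norm (p - v)" if "t \<in> ?T" for t
  proof -
    have "norm (t *\<^sub>R (p - v)) \<le> norm (ray t) + norm v"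
      unfolding ray_def by (metis add_diff_cancel_left' norm_triangle_ineq4)
    also have "\<dots> \<le> B + norm v" using that B by auto
    finally have "\<bar>t\<bar> * norm (p - v) \<le> B + norm v" by simp
    moreover have "t * norm (p - v) \<le> \<bar>t\<bar> * norm (p - v)"
      by (intro mult_right_mono) auto
    ultimately have "t * norm (p - v) \<le> B + norm v" by linarith
    then show ?thesis
      using False by (simp add: pos_le_divide_eq)
  qed
  have "1 \<in> ?T" using p by (simp add: ray_def)
  moreover have bdd: "bdd_above ?T" using bound by (rule bdd_above.I)
  ultimately have m: "Sup ?T \<in> ?T"
    using closed_contains_Sup[of ?T] \<open>closed ?T\<close> by (metis empty_iff)
  have "Sup ?T \<ge> 1" using cSup_upper[OF \<open>1 \<in> ?T\<close> bdd] .
  define m where "m = Sup ?T"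
  define q where "q = ray m"
  have "m \<ge> 1" "q \<in> C" using m \<open>Sup ?T \<ge> 1\<close> by (auto simp: q_def m_def)
  \<comment> \<open>the smallest face containing \<open>q\<close>; a facet of it through \<open>q\<close> would be smaller\<close>
  define F where "F = \<Inter>{F. F face_of C \<and> q \<in> F}"
  have F: "F face_of C"
    unfolding F_def using \<open>q \<in> C\<close> face_of_refl[OF \<open>convex C\<close>] by (intro face_of_Inter) auto
  have "q \<in> F" by (auto simp: F_def)
  have "q \<in> rel_interior F"
  proof (rule ccontr)
    assume "q \<notin> rel_interior F"
    moreover have "polyhedron F"
      using F C face_of_polytope_polytope polytope_imp_polyhedron by blast
    ultimately obtain F' where F': "F' facet_of F" "q \<in> F'"
      using rel_boundary_of_polyhedron \<open>q \<in> F\<close> by blast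
    then have "F' face_of C" using F facet_of_imp_face_of face_of_trans by blast
    then have "F \<subseteq> F'" using F'(2) by (auto simp: F_def)
    then show False using F'(1) by (metis facet_of_imp_subset facet_of_irrefl subset_antisym)
  qed
  have "v \<notin> F"
  proof
    assume "v \<in> F"
    then obtain e where e: "e > 1" "(1 - e) *\<^sub>R v + e *\<^sub>R q \<in> F"
      using \<open>q \<in> rel_interior F\<close> face_of_imp_convex[OF F] \<open>q \<in> F\<close>
        convex_rel_interior_iff[of F q] by blast
    have "(1 - e) *\<^sub>R v + e *\<^sub>R q = ray (e * m)"
      by (simp add: q_def ray_def algebra_simps)
    then have "e * m \<in> ?T" using e face_of_imp_subset[OF F] by auto
    then have "e * m \<le> m" using cSup_upper[OF _ bdd] unfolding m_def by metis
    then show False using e(1) \<open>m \<ge> 1\<close> by simp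
  qed
  moreover have "p = (1 - 1 / m) *\<^sub>R v + (1 / m) *\<^sub>R q"
    using \<open>m \<ge> 1\<close> by (simp add: q_def ray_def algebra_simps)
  then have "p \<in> convex hull insert v F"
    using \<open>m \<ge> 1\<close> \<open>q \<in> F\<close> by (simp add: convexD hull_inc)
  ultimately show ?thesis using F by blast
qed

lemma Union_pull:
  assumes "polytopal_complex K"
  shows "\<Union>(pull v K) = \<Union>K"
proof (intro equalityI subsetI)
  fix p assume "p \<in> \<Union>(pull v K)"
  then consider C where "C \<in> K" "p \<in> C"
    | C F where "C \<in> K" "v \<in> C" "F face_of C" "p \<in> convex hull insert v F"
    unfolding pull_def by blast
  then show "p \<in> \<Union>K"
  proof cases
    case (2 C F)
    then have "convex hull insert v F \<subseteq> C"
      using polytopal_complexD(2)[OF assms] face_of_imp_subset[of F C]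
      by (simp add: hull_minimal polytope_imp_convex)
    then show ?thesis using 2 by blast
  qed auto
next
  fix p assume "p \<in> \<Union>K"
  then obtain C where C: "C \<in> K" "p \<in> C" by blast
  show "p \<in> \<Union>(pull v K)"
  proof (cases "v \<in> C")
    case True
    then obtain F where "F face_of C" "v \<notin> F" "p \<in> convex hull insert v F"
      using C(2) polytope_covered_by_pyramids[OF polytopal_complexD(2)[OF assms C(1)]] by blast
    then show ?thesis using C True unfolding pull_def by blast
  qed (use C in \<open>auto simp: pull_def\<close>)
qed

proposition polytopal_complex_pull:
  assumes K: "polytopal_complex K"
  shows "polytopal_complex (pull v K)"
proof -
  note fin = polytopal_complexD(1)[OF K] and poly = polytopal_complexD(2)[OF K]
    and face = polytopal_complexD(3)[OF K] and int = polytopal_complexD(4)[OF K]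
  have conv: "convex C" if "C \<in> K" for C
    using poly that polytope_imp_convex by blast
  define base where "base F \<longleftrightarrow> v \<notin> F \<and> (\<exists>C\<in>K. v \<in> C \<and> F face_of C)" for F
  have base: "F \<in> K" "v \<notin> affine hull F" if "base F" for F
    using that apex_notin_affine_hull conv face by (auto simp: base_def)
  have pull: "D \<in> pull v K \<longleftrightarrow> (D \<in> K \<and> v \<notin> D) \<or> (\<exists>F. base F \<and> D = convex hull insert v F)" for D
    by (auto simp: pull_def base_def)
  have pyr: "G face_of convex hull insert v F \<longleftrightarrow>
           G face_of F \<or> (\<exists>G'. G' face_of F \<and> G = convex hull insert v G')" if "base F" for F G
    using that base poly by (intro face_of_pyramid_iff) auto
  have sub: "base G" if "base F" "G face_of F" for F G
    using that(1) face_of_imp_subset[OF that(2)] face_of_trans[OF that(2)]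
    unfolding base_def by blast
  have Int_cell: "(convex hull insert v F) \<inter> D = F \<inter> D" if "base F" "D \<in> K" "v \<notin> D" for F D
  proof -
    obtain C where C: "C \<in> K" "v \<in> C" "F face_of C" and "v \<notin> F"
      using \<open>base F\<close> by (auto simp: base_def)
    then show ?thesis
      using pyramid_Int_cell[OF C(3) conv C(2) _ int] that by simp
  qed
  have Int_pyr: "(convex hull insert v F) \<inter> (convex hull insert v G) = convex hull insert v (F \<inter> G)"
    if "base F" "base G" for F G
  proof -
    obtain C where C: "C \<in> K" "v \<in> C" "F face_of C" "v \<notin> F"
      using \<open>base F\<close> by (auto simp: base_def)
    obtain D where D: "D \<in> K" "v \<in> D" "G face_of D" "v \<notin> G"
      using \<open>base G\<close> by (auto simp: base_def)
    have "C \<inter> D face_of D" using int[of D C] C(1) D(1) by (simp add: Int_commute)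
    then show ?thesis
      using pyramid_Int_pyramid[OF C(3) conv C(2,4) D(3) conv D(2,4) int] C(1) D(1) by simp
  qed
  show ?thesis
    unfolding polytopal_complex_def
  proof (intro conjI ballI allI impI)
    have "pull v K \<subseteq> K \<union> (\<lambda>F. convex hull insert v F) ` K"
      using base by (auto simp: pull)
    then show "finite (pull v K)" using finite_subset fin by blast
  next
    fix D assume "D \<in> pull v K"
    then show "polytope D"
      using base(1) poly polytope_convex_hull_insert by (auto simp: pull)
  next
    fix D G assume D: "D \<in> pull v K" and G: "G face_of D"
    show "G \<in> pull v K"
    proof (cases "D \<in> K \<and> v \<notin> D")
      case True
      then have "G \<in> K" "v \<notin> G"
        using face[OF _ G] face_of_imp_subset[OF G] by auto
      then show ?thesis by (simp add: pull)
    next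
      case False
      then obtain F where F: "base F" "D = convex hull insert v F"
        using D by (auto simp: pull)
      then consider "G face_of F" | G' where "G' face_of F" "G = convex hull insert v G'"
        using G pyr[OF F(1)] by auto
      then show ?thesis
      proof cases
        case 1
        then have "base G" using sub[OF F(1)] by simp
        then show ?thesis using base(1)[of G] by (simp add: pull base_def)
      next
        case 2
        then show ?thesis using sub[OF F(1)] pull by auto
      qed
    qed
  next
    fix D E assume D: "D \<in> pull v K" and E: "E \<in> pull v K"
    consider "D \<in> K" "v \<notin> D" "E \<in> K" "v \<notin> E"
      | F where "D \<in> K" "v \<notin> D" "base F" "E = convex hull insert v F"
      | F where "base F" "D = convex hull insert v F" "E \<in> K" "v \<notin> E"
      | F G where "base F" "D = convex hull insert v F" "base G" "E = convex hull insert v G"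
      using D E by (auto simp: pull)
    then show "D \<inter> E face_of D"
    proof cases
      case 1 then show ?thesis using int by simp
    next
      case 2
      then show ?thesis
        using Int_cell[of F D] int[of D F] base(1)[of F] by (simp add: Int_commute)
    next
      case 3
      have "F \<inter> E face_of F" using 3 int[of F E] base(1)[of F] by simp
      then show ?thesis using 3 Int_cell[of F E] pyr by simp
    next
      case 4
      have "F \<inter> G face_of F" using 4 int[of F G] base(1)[of F] base(1)[of G] by simp
      then show ?thesis using 4 Int_pyr[of F G] pyr by auto
    qed
  qed
qed

lemma pulling_complex:
  assumes "polytope P"
  shows "polytopal_complex (pulling P vs) \<and> \<Union>(pulling P vs) = P"
proof -
  have "polytopal_complex (fold pull vs K) \<and> \<Union>(fold pull vs K) = \<Union>K"
    if "polytopal_complex K" for K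
    using that by (induction vs arbitrary: K) (simp_all add: polytopal_complex_pull Union_pull)
  then show ?thesis
    using polytopal_complex_trivial_subdivision[OF assms]
      Union_trivial_subdivision[OF polytope_imp_convex[OF assms]]
    unfolding pulling_def by simp
qed

section \<open>Faces of a polytope given by inequalities\<close>

definition solutions :: "('a::euclidean_space \<times> real) set \<Rightarrow> 'a set" where
  "solutions H = {x. \<forall>(a, b)\<in>H. a \<bullet> x \<le> b}"

definition tight :: "('a::euclidean_space \<times> real) set \<Rightarrow> 'a \<Rightarrow> ('a \<times> real) set" where
  "tight H x = {(a, b)\<in>H. a \<bullet> x = b}"

lemma convex_solutions: "convex (solutions H)"
proof -
  have "solutions H = (\<Inter>(a, b)\<in>H. {x. a \<bullet> x \<le> b})"
    by (auto simp: solutions_def)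
  then show ?thesis
    by (auto intro!: convex_INT simp: convex_halfspace_le)
qed

lemma closed_solutions: "closed (solutions H)"
proof -
  have "solutions H = (\<Inter>(a, b)\<in>H. {x. a \<bullet> x \<le> b})"
    by (auto simp: solutions_def)
  then show ?thesis
    by (auto intro!: closed_INT simp: closed_halfspace_le)
qed

text \<open>
  If \<open>y\<close> lies on all bounding hyperplanes on which \<open>x\<close> lies, the segment from \<open>y\<close> to \<open>x\<close> can be
  prolonged a little beyond \<open>x\<close> inside the polyhedron: along it the tight inequalities stay tight and
  the others have room.  So \<open>x\<close> is an inner point of a segment starting at \<open>y\<close>.
\<close>

lemma face_contains_if_tight_subset:
  assumes "finite H" and F: "F face_of solutions H"
    and x: "x \<in> F" and y: "y \<in> solutions H" and sub: "tight H x \<subseteq> tight H y"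
  shows "y \<in> F"
proof (cases "y = x")
  case False
  have xS: "x \<in> solutions H" using face_of_imp_subset[OF F] x by blast
  \<comment> \<open>the segment from \<open>y\<close> to \<open>x\<close>, prolonged beyond \<open>x\<close> by the fraction \<open>e\<close>\<close>
  define z where "z e = x + e *\<^sub>R (x - y)" for e
  have "\<forall>\<^sub>F e in at_right 0. \<forall>h\<in>H. fst h \<bullet> z e \<le> snd h"
  proof (rule eventually_ball_finite[OF \<open>finite H\<close>], rule ballI)
    fix h assume h: "h \<in> H"
    obtain a b where ab: "h = (a, b)" by (cases h)
    have "a \<bullet> x \<le> b" using xS h ab by (auto simp: solutions_def)
    then consider "a \<bullet> x = b" | "a \<bullet> x < b" by linarith
    then show "\<forall>\<^sub>F e in at_right 0. fst h \<bullet> z e \<le> snd h"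
    proof cases
      case 1
      then have "(a, b) \<in> tight H x" using h ab by (simp add: tight_def)
      then have "a \<bullet> y = b" using sub by (auto simp: tight_def)
      then show ?thesis
        using 1 by (simp add: z_def ab inner_add_right inner_diff_right)
    next
      case 2
      have "((\<lambda>e. a \<bullet> z e) \<longlongrightarrow> a \<bullet> (x + 0 *\<^sub>R (x - y))) (at_right 0)"
        unfolding z_def by (intro tendsto_intros)
      then have "\<forall>\<^sub>F e in at_right 0. a \<bullet> z e < b"
        using 2 by (intro order_tendstoD(2)) auto
      then show ?thesis
        by (rule eventually_mono) (simp add: ab)
    qed
  qed
  then have "\<forall>\<^sub>F e in at_right (0::real). 0 < e \<and> (\<forall>h\<in>H. fst h \<bullet> z e \<le> snd h)"
    by (rule eventually_conj[OF eventually_at_right_less])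
  then obtain e where e: "0 < e" "\<forall>h\<in>H. fst h \<bullet> z e \<le> snd h"
    using eventually_happens'[OF trivial_limit_at_right_real] by blast
  then have zS: "z e \<in> solutions H" by (auto simp: solutions_def)
  have "(1 + e) *\<^sub>R x = e *\<^sub>R y + z e" by (simp add: z_def algebra_simps)
  then have "(1 / (1 + e)) *\<^sub>R ((1 + e) *\<^sub>R x) = (1 / (1 + e)) *\<^sub>R (e *\<^sub>R y + z e)" by simp
  then have "x = (e / (1 + e)) *\<^sub>R y + (1 / (1 + e)) *\<^sub>R z e"
    using e(1) by (simp add: scaleR_add_right)
  moreover have "1 - 1 / (1 + e) = e / (1 + e)" using e(1) by (simp add: field_simps)
  moreover have "y \<noteq> z e"
  proof
    assume "y = z e"
    then have "(1 + e) *\<^sub>R (x - y) = 0" by (simp add: z_def algebra_simps)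
    then show False using e(1) False by simp
  qed
  ultimately have "x \<in> open_segment y (z e)"
    using e(1) by (auto simp: in_segment intro!: exI[of _ "1 / (1 + e)"])
  then show ?thesis
    using face_ofD[OF F _ y zS x] by blast
qed (use x in simp)

text \<open>
  For an extreme point \<open>x\<close>, the preceding lemma applied to the face \<open>{x}\<close> shows that the vertex
  provided by the hypothesis is \<open>x\<close> itself.  So \<open>V\<close> contains all extreme points, and these span a
  compact convex set by the Krein-Milman theorem.
\<close>

proposition solutions_eq_convex_hull:
  assumes "finite H" and V: "V \<subseteq> solutions H" and bounded: "bounded (solutions H)"
    and vertex: "\<And>x. x \<in> solutions H \<Longrightarrow> \<exists>y\<in>V. tight H x \<subseteq> tight H y"
  shows "solutions H = convex hull V"
proof (rule antisym)
  have "x \<in> V" if x: "x extreme_point_of solutions H" for x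
  proof -
    have "x \<in> solutions H" using x by (simp add: extreme_point_of_def)
    then obtain y where y: "y \<in> V" "tight H x \<subseteq> tight H y" using vertex by blast
    have "y \<in> {x}"
      using x face_contains_if_tight_subset[OF assms(1) _ _ _ y(2), of "{x}"] V y(1)
      by (auto simp: face_of_singleton)
    then show ?thesis using y(1) by simp
  qed
  then have "convex hull {x. x extreme_point_of solutions H} \<subseteq> convex hull V"
    by (intro hull_mono) auto
  moreover have "compact (solutions H)"
    using bounded closed_solutions by (simp add: compact_eq_bounded_closed)
  ultimately show "solutions H \<subseteq> convex hull V"
    using Krein_Milman_Minkowski convex_solutions by blast
  show "convex hull V \<subseteq> solutions H"
    by (rule hull_minimal) (simp_all add: V convex_solutions)
qed

text \<open>
  The set \<open>J\<close> for a non-empty face consists of the inequalities that are tight on the whole face.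
  They are exactly the ones tight at some single point, because the midpoint of two points is tight
  only where both points are.  Any vertex tight there belongs to the face.
\<close>

proposition face_of_solutions_iff:
  assumes "finite H" "finite V" and P: "solutions H = convex hull V"
  shows "F face_of solutions H \<longleftrightarrow> F = {} \<or> (\<exists>J\<subseteq>H. F = convex hull {y\<in>V. J \<subseteq> tight H y})"
proof -
  have VS: "V \<subseteq> solutions H" using P hull_subset by metis
  have hull: "F = convex hull {y\<in>V. y \<in> F}" if "F face_of solutions H" for F
  proof -
    have "F face_of convex hull V" using that by (simp add: P)
    then obtain W where W: "W \<subseteq> V" "F = convex hull W"
      by (rule face_of_convex_hull_subset[OF finite_imp_compact[OF \<open>finite V\<close>]])
    then have "W \<subseteq> {y\<in>V. y \<in> F}" using hull_subset[of W convex] by auto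
    then have "F \<subseteq> convex hull {y\<in>V. y \<in> F}" unfolding W(2) by (rule hull_mono)
    moreover have "convex hull {y\<in>V. y \<in> F} \<subseteq> F"
      by (rule hull_minimal) (auto simp: face_of_imp_convex[OF that])
    ultimately show ?thesis by blast
  qed
  show ?thesis
  proof
    assume F: "F face_of solutions H"
    show "F = {} \<or> (\<exists>J\<subseteq>H. F = convex hull {y\<in>V. J \<subseteq> tight H y})"
    proof (cases "F = {}")
      case False
      then obtain x where x: "x \<in> F"
        and min: "\<And>y. y \<in> F \<Longrightarrow> card (tight H x) \<le> card (tight H y)"
        using exists_least_iff[of "\<lambda>n. \<exists>x\<in>F. card (tight H x) = n"] by (metis ex_in_conv not_le)
      \<comment> \<open>the midpoint \<open>m\<close> of \<open>x\<close> and \<open>y\<close> is tight only where both are, so minimality of \<open>x\<close> applies to \<open>m\<close>\<close>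
      have sub: "tight H x \<subseteq> tight H y" if y: "y \<in> F" for y
      proof -
        define m where "m = (1/2) *\<^sub>R x + (1/2) *\<^sub>R y"
        have "m \<in> F"
          unfolding m_def using x y face_of_imp_convex[OF F] by (intro convexD) auto
        have inS: "x \<in> solutions H" "y \<in> solutions H"
          using face_of_imp_subset[OF F] x y by auto
        have *: "a \<bullet> x = b \<and> a \<bullet> y = b" if "(a, b) \<in> H" "a \<bullet> m = b" for a b
        proof -
          have "a \<bullet> x \<le> b" "a \<bullet> y \<le> b" using inS that(1) by (auto simp: solutions_def)
          moreover have "a \<bullet> x + a \<bullet> y = 2 * b"
            using that(2) by (simp add: m_def inner_add_right)
          ultimately show ?thesis by linarith
        qed
        have "tight H m \<subseteq> tight H x" "tight H m \<subseteq> tight H y"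
          using * by (auto simp: tight_def)
        moreover have "finite (tight H x)"
          using \<open>finite H\<close> by (rule finite_subset[rotated]) (auto simp: tight_def)
        ultimately have "tight H m = tight H x"
          using min[OF \<open>m \<in> F\<close>] by (intro card_seteq)
        then show ?thesis using \<open>tight H m \<subseteq> tight H y\<close> by simp
      qed
      have "{y\<in>V. y \<in> F} = {y\<in>V. tight H x \<subseteq> tight H y}"
        using sub VS face_contains_if_tight_subset[OF \<open>finite H\<close> F x] by blast
      moreover have "tight H x \<subseteq> H" by (auto simp: tight_def)
      ultimately show ?thesis using hull[OF F] by metis
    qed simp
  next
    assume "F = {} \<or> (\<exists>J\<subseteq>H. F = convex hull {y\<in>V. J \<subseteq> tight H y})"
    then show "F face_of solutions H"
    proof (elim disjE exE conjE)
      fix J assume J: "J \<subseteq> H" "F = convex hull {y\<in>V. J \<subseteq> tight H y}"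
      define G where "G = {x\<in>solutions H. J \<subseteq> tight H x}"
      have "G face_of solutions H"
      proof (cases "J = {}")
        case True
        then show ?thesis by (simp add: G_def face_of_refl convex_solutions)
      next
        case False
        have "G = (\<Inter>(a, b)\<in>J. solutions H \<inter> {x. a \<bullet> x = b})"
          using False J(1) by (auto simp: G_def tight_def)
        also have "\<dots> face_of solutions H"
        proof (rule face_of_Inter)
          fix T assume "T \<in> (\<lambda>(a, b). solutions H \<inter> {x. a \<bullet> x = b}) ` J"
          then obtain a b where ab: "(a, b) \<in> J" and T: "T = solutions H \<inter> {x. a \<bullet> x = b}"
            by auto
          have "a \<bullet> x \<le> b" if "x \<in> solutions H" for x
            using that ab J(1) by (auto simp: solutions_def)
          then show "T face_of solutions H"
            unfolding T by (rule face_of_Int_supporting_hyperplane_le[OF convex_solutions])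
        qed (use False in simp)
        finally show ?thesis .
      qed
      moreover have "{y\<in>V. y \<in> G} = {y\<in>V. J \<subseteq> tight H y}"
        using VS by (auto simp: G_def)
      ultimately show ?thesis using hull[of G] J(2) by simp
    qed simp
  qed
qed

section \<open>Cells spanned by 0/1 points\<close>

definition zero_one :: "(real^'n) set" where
  "zero_one = {p. \<forall>k. p $ k = 0 \<or> p $ k = 1}"

text \<open>
  The 0/1 points are the vertices of the unit cube.  An extreme point of the cube is extreme in
  every subset that contains it, which is why 0/1 points are always in convex position.
\<close>

lemma zero_one_extreme_point:
  assumes "p \<in> zero_one"
  shows "p extreme_point_of cbox 0 1"
  unfolding extreme_point_of_def
proof (intro conjI ballI notI)
  have "0 \<le> p $ k \<and> p $ k \<le> 1" for k
  proof -
    have "p $ k = 0 \<or> p $ k = 1" using assms by (simp add: zero_one_def)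
    then show ?thesis by auto
  qed
  then show "p \<in> cbox 0 1" by (simp add: mem_box_cart)
  fix a b assume ab: "a \<in> cbox 0 1" "b \<in> cbox 0 1" and p: "p \<in> open_segment a b"
  obtain u where u: "0 < u" "u < 1" "p = (1 - u) *\<^sub>R a + u *\<^sub>R b" and "a \<noteq> b"
    using p by (auto simp: in_segment)
  have "a $ k = b $ k" for k
  proof -
    have *: "0 \<le> a $ k" "a $ k \<le> 1" "0 \<le> b $ k" "b $ k \<le> 1"
      using ab by (auto simp: mem_box_cart)
    have eq: "p $ k = (1 - u) * a $ k + u * b $ k" using u(3) by simp
    have nn: "0 \<le> (1 - u) * a $ k" "0 \<le> u * b $ k"
      "0 \<le> (1 - u) * (1 - a $ k)" "0 \<le> u * (1 - b $ k)"
      using u * by auto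
    from assms consider "p $ k = 0" | "p $ k = 1" by (auto simp: zero_one_def)
    then show ?thesis
    proof cases
      case 1
      then have "(1 - u) * a $ k = 0" "u * b $ k = 0" using eq nn by linarith+
      then show ?thesis using u by simp
    next
      case 2
      have "(1 - u) * (1 - a $ k) + u * (1 - b $ k) = 0" using eq 2 by (simp add: algebra_simps)
      then have "(1 - u) * (1 - a $ k) = 0" "u * (1 - b $ k) = 0" using nn by linarith+
      then show ?thesis using u by simp
    qed
  qed
  then show False using \<open>a \<noteq> b\<close> by (simp add: vec_eq_iff)
qed

lemma zero_one_in_convex_hull:
  assumes "W \<subseteq> zero_one" "p \<in> zero_one" "p \<in> convex hull W"
  shows "p \<in> W"
proof -
  have "convex hull W \<subseteq> cbox 0 1"
    using assms(1) zero_one_extreme_point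
    by (intro hull_minimal) (auto simp: extreme_point_of_def)
  then have "p extreme_point_of convex hull W"
    using zero_one_extreme_point[OF assms(2)] assms(3)
    by (auto simp: extreme_point_of_def)
  then show ?thesis by (rule extreme_point_of_convex_hull)
qed

lemma integral_in_unit_cube:
  assumes "p \<in> cbox 0 1" "\<forall>k. p $ k \<in> \<int>"
  shows "p \<in> zero_one"
  unfolding zero_one_def
proof (clarsimp)
  fix k assume "p $ k \<noteq> 1"
  obtain m :: int where m: "p $ k = of_int m" using assms(2) Ints_cases by metis
  have "0 \<le> p $ k" "p $ k \<le> 1" using assms(1) by (auto simp: mem_box_cart)
  then have "0 \<le> m" "m \<le> 1" using m by auto
  then show "p $ k = 0" using m \<open>p $ k \<noteq> 1\<close> by (cases "m = 0") auto
qed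

text \<open>
  The shadow of \<^const>\<open>pull\<close> on vertex index sets: a base \<open>B\<close> for a new cell is a cell that misses \<open>i\<close> and
  is contained in, hence a face of, some cell through \<open>i\<close>.
\<close>

definition pull_sets :: "nat \<Rightarrow> nat set set \<Rightarrow> nat set set" where
  "pull_sets i \<A> = {A \<in> \<A>. i \<notin> A} \<union>
     insert i ` {B \<in> \<A>. i \<notin> B \<and> (\<exists>A\<in>\<A>. i \<in> A \<and> B \<subseteq> A)}"

locale zero_one_points =
  fixes v :: "nat \<Rightarrow> real^'n" and N :: "nat set"
  assumes inj: "inj_on v N" and vertices: "v ` N \<subseteq> zero_one" and fin: "finite N"
begin

lemma vertex_in_cell_iff:
  assumes "A \<subseteq> N" "i \<in> N"
  shows "v i \<in> cell v A \<longleftrightarrow> i \<in> A"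
proof
  assume "v i \<in> cell v A"
  then have "v i \<in> v ` A"
    unfolding cell_def using assms vertices by (intro zero_one_in_convex_hull[of "v ` A"]) auto
  then show "i \<in> A" using inj assms by (auto simp: inj_on_def)
qed (auto simp: cell_def intro: hull_inc)

lemma cell_subset_iff:
  assumes "A \<subseteq> N" "B \<subseteq> N"
  shows "cell v A \<subseteq> cell v B \<longleftrightarrow> A \<subseteq> B"
proof
  assume "cell v A \<subseteq> cell v B"
  then show "A \<subseteq> B" using vertex_in_cell_iff assms by blast
qed (simp add: cell_def hull_mono image_mono)

lemma pull_cells:
  assumes K: "polytopal_complex (cell v ` \<A>)" and sub: "\<A> \<subseteq> Pow N" and i: "i \<in> N"
  shows "pull (v i) (cell v ` \<A>) = cell v ` pull_sets i \<A>"
proof -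
  have mem: "v i \<in> cell v A \<longleftrightarrow> i \<in> A" if "A \<in> \<A>" for A
    using vertex_in_cell_iff that sub i by blast
  have face: "cell v B face_of cell v A \<longleftrightarrow> B \<subseteq> A" if "A \<in> \<A>" "B \<in> \<A>" for A B
  proof -
    have "cell v B face_of cell v A \<longleftrightarrow> cell v B \<subseteq> cell v A"
      using K that by (intro polytopal_complex_face_iff) auto
    then show ?thesis using cell_subset_iff[of B A] that sub by blast
  qed
  have pyramid: "convex hull insert (v i) (cell v B) = cell v (insert i B)" for B
    unfolding cell_def image_insert by (rule hull_insert[symmetric])
  have "{C \<in> cell v ` \<A>. v i \<notin> C} = cell v ` {A \<in> \<A>. i \<notin> A}"
    using mem by auto
  moreover have "{convex hull insert (v i) F | C F.
        C \<in> cell v ` \<A> \<and> v i \<in> C \<and> F face_of C \<and> v i \<notin> F} =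
      cell v ` insert i ` {B \<in> \<A>. i \<notin> B \<and> (\<exists>A\<in>\<A>. i \<in> A \<and> B \<subseteq> A)}" (is "?L = ?R")
  proof (intro equalityI subsetI)
    fix D assume "D \<in> ?L"
    then obtain A F where A: "A \<in> \<A>" "i \<in> A"
      and F: "F face_of cell v A" "v i \<notin> F" "D = convex hull insert (v i) F"
      using mem by blast
    have "F \<in> cell v ` \<A>" using polytopal_complexD(3)[OF K _ F(1)] A by simp
    then obtain B where B: "B \<in> \<A>" "F = cell v B" by blast
    then have "i \<notin> B" "B \<subseteq> A" using F A mem face by auto
    then have "insert i B \<in> insert i ` {B \<in> \<A>. i \<notin> B \<and> (\<exists>A\<in>\<A>. i \<in> A \<and> B \<subseteq> A)}"
      using A B by blast
    then show "D \<in> ?R" using F(3) B(2) pyramid by auto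
  next
    fix D assume "D \<in> ?R"
    then obtain A B where *: "A \<in> \<A>" "B \<in> \<A>" "i \<in> A" "i \<notin> B" "B \<subseteq> A"
      and "D = cell v (insert i B)" by blast
    then have "D = convex hull insert (v i) (cell v B)" "v i \<in> cell v A" "v i \<notin> cell v B"
        "cell v B face_of cell v A"
      using face mem pyramid by auto
    then show "D \<in> ?L" using * by blast
  qed
  ultimately show ?thesis
    unfolding pull_def pull_sets_def image_Un by simp
qed

lemma pulling_cells:
  assumes "polytope P" and "trivial_subdivision P = cell v ` \<A>"
    and "\<A> \<subseteq> Pow N" "set is \<subseteq> N"
  shows "pulling P (map v is) = cell v ` fold pull_sets is \<A>"
proof -
  have "fold pull (map v is) (cell v ` \<B>) = cell v ` fold pull_sets is \<B>"
    if "polytopal_complex (cell v ` \<B>)" "\<B> \<subseteq> Pow N" for \<B>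
    using that assms(4)
  proof (induction "is" arbitrary: \<B>)
    case (Cons i "is")
    then have i: "i \<in> N" by simp
    have "polytopal_complex (cell v ` pull_sets i \<B>)"
      using polytopal_complex_pull[OF Cons.prems(1), of "v i"]
      by (simp add: pull_cells[OF Cons.prems(1,2) i])
    moreover have "pull_sets i \<B> \<subseteq> Pow N"
      using Cons.prems(2) i unfolding pull_sets_def by blast
    ultimately show ?case
      using Cons.IH[of "pull_sets i \<B>"] Cons.prems(3)
      by (simp add: pull_cells[OF Cons.prems(1,2) i])
  qed simp
  moreover have "polytopal_complex (cell v ` \<A>)"
    using polytopal_complex_trivial_subdivision[OF assms(1)] by (simp add: assms(2))
  ultimately show ?thesis
    using assms(3) unfolding pulling_def assms(2) by blast
qed

text \<open>
  Adding the points of \<open>A\<close> one at a time runs through a chain of faces, and a point of a cell outside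
  one of its faces is also outside the affine hull of that face.
\<close>

lemma affine_independent_if_subsets_cells:
  assumes K: "polytopal_complex (cell v ` \<A>)" and "Pow A \<subseteq> \<A>" "A \<subseteq> N"
  shows "\<not> affine_dependent (v ` A)"
proof -
  have "finite A" using fin assms(3) finite_subset by blast
  then show ?thesis using assms(2,3)
  proof (induction A)
    case (insert i B)
    have "cell v B face_of cell v (insert i B)"
      using insert.prems by (intro polytopal_complex_face_iff[OF K, THEN iffD2])
        (auto simp: cell_subset_iff)
    moreover have "v i \<notin> cell v B" "v i \<in> cell v (insert i B)"
      using insert.prems insert.hyps by (auto simp: vertex_in_cell_iff)
    moreover have "convex (cell v (insert i B))" by (simp add: cell_def)
    ultimately have "v i \<notin> affine hull (cell v B)"
      by (metis apex_notin_affine_hull)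
    then have "v i \<notin> affine hull (v ` B)" by (simp add: cell_def)
    moreover have "\<not> affine_dependent (v ` B)" using insert by blast
    ultimately show ?case by (simp add: affine_independent_insert)
  qed simp
qed

end

text \<open>
  The hull lies in the unit cube, whose lattice points are its vertices.
\<close>

lemma lattice_points_zero_one_hull:
  assumes "W \<subseteq> zero_one"
  shows "lattice_points (convex hull W) = W"
proof
  have "convex hull W \<subseteq> cbox 0 1"
    using assms zero_one_extreme_point
    by (intro hull_minimal) (auto simp: extreme_point_of_def)
  then have "p \<in> W" if "p \<in> lattice_points (convex hull W)" for p
    using that assms by (intro zero_one_in_convex_hull[of W])
      (auto simp: lattice_points_def intro: integral_in_unit_cube)
  then show "lattice_points (convex hull W) \<subseteq> W" by blast
  show "W \<subseteq> lattice_points (convex hull W)"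
  proof
    fix p assume "p \<in> W"
    moreover have "p $ k \<in> \<int>" for k
    proof -
      have "p $ k = 0 \<or> p $ k = 1" using \<open>p \<in> W\<close> assms by (auto simp: zero_one_def)
      then show ?thesis by auto
    qed
    ultimately show "p \<in> lattice_points (convex hull W)"
      by (auto simp: lattice_points_def intro: hull_inc)
  qed
qed

text \<open>
  The flag complex on \<open>N\<close> whose minimal non-faces are the pairs in \<open>E\<close>.
\<close>

definition flag_sets :: "nat set \<Rightarrow> (nat \<times> nat) set \<Rightarrow> nat set set" where
  "flag_sets N E = {A. A \<subseteq> N \<and> (\<forall>(i, j)\<in>E. \<not> {i, j} \<subseteq> A)}"

context zero_one_points
begin

text \<open>
  Everything claimed about a triangulation follows once its cells are known to be indexed by a flag
  complex: closure under subsets makes the cells simplices, and the combinatorial non-faces are the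
  geometric ones because a vertex lies in a cell only if its index belongs to the index set.
\<close>

lemma flag_triangulation:
  assumes K: "polytopal_complex (cell v ` flag_sets N E)"
    and P: "\<Union>(cell v ` flag_sets N E) = P" "P = cell v N"
    and E: "\<forall>(i, j)\<in>E. i \<in> N \<and> j \<in> N \<and> i \<noteq> j"
  defines "T \<equiv> cell v ` flag_sets N E"
  shows "lattice_triangulation_of T P" (is ?tri)
    and "\<And>d. {C \<in> T. aff_dim C = int d} = cell v ` {A \<in> flag_sets N E. card A = Suc d}"
    and "minimal_non_faces P T = (`) v ` (\<lambda>(i, j). {i, j}) ` E" (is ?mnf)
proof -
  have sub: "A \<subseteq> N" if "A \<in> flag_sets N E" for A
    using that by (simp add: flag_sets_def)
  have down: "B \<in> flag_sets N E" if "A \<in> flag_sets N E" "B \<subseteq> A" for A B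
    using that unfolding flag_sets_def by fast
  have indep: "\<not> affine_dependent (v ` A)" if "A \<in> flag_sets N E" for A
    using affine_independent_if_subsets_cells[OF K _ sub[OF that]] down[OF that] by blast
  have card: "card (v ` A) = card A" if "A \<in> flag_sets N E" for A
    using card_image[OF inj_on_subset[OF inj sub[OF that]]] .
  have lat: "lattice_points P = v ` N"
    using lattice_points_zero_one_hull[OF vertices] by (simp add: P(2) cell_def)
  show ?tri
    unfolding lattice_triangulation_of_def
  proof (intro conjI ballI allI impI)
    have "\<forall>C\<in>T. \<exists>n. n simplex C"
    proof
      fix C assume "C \<in> T"
      then obtain A where A: "A \<in> flag_sets N E" "C = cell v A" unfolding T_def by blast
      then have "(int (card A) - 1) simplex C"
        unfolding simplex_def cell_def using indep card
        by (intro exI[of _ "v ` A"]) auto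
      then show "\<exists>n. n simplex C" ..
    qed
    moreover have "\<forall>F C. C \<in> T \<and> F face_of C \<longrightarrow> F \<in> T"
      unfolding T_def using polytopal_complexD(3)[OF K] by blast
    moreover have "\<forall>C D. C \<in> T \<and> D \<in> T \<longrightarrow> C \<inter> D face_of C"
      unfolding T_def using polytopal_complexD(4)[OF K] by blast
    moreover have "finite T"
      unfolding T_def by (rule polytopal_complexD(1)[OF K])
    ultimately show "simplicial_complex T"
      unfolding simplicial_complex_def by (intro conjI)
    show "\<Union>T = P" using P(1) by (simp add: T_def)
    fix C p assume "C \<in> T" "p extreme_point_of C"
    then obtain A where "A \<in> flag_sets N E" "p extreme_point_of convex hull (v ` A)"
      using T_def by (auto simp: cell_def)
    then have "p \<in> v ` N" using extreme_point_of_convex_hull sub by blast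
    then show "p \<in> lattice_points P" using lat by simp
  qed
  have "aff_dim (cell v A) = int d \<longleftrightarrow> card A = Suc d" if "A \<in> flag_sets N E" for A d
    using aff_dim_affine_independent[OF indep[OF that]] card[OF that]
    by (auto simp: cell_def aff_dim_convex_hull)
  then show "{C \<in> T. aff_dim C = int d} = cell v ` {A \<in> flag_sets N E. card A = Suc d}" for d
    unfolding T_def by auto
  have covered: "(\<exists>F\<in>T. v ` I \<subseteq> F) \<longleftrightarrow> I \<in> flag_sets N E" if "I \<subseteq> N" for I
  proof -
    have "v ` I \<subseteq> cell v A \<longleftrightarrow> I \<subseteq> A" if "A \<in> flag_sets N E" for A
      using vertex_in_cell_iff[OF sub[OF that]] \<open>I \<subseteq> N\<close> by blast
    then have "(\<exists>F\<in>T. v ` I \<subseteq> F) \<longleftrightarrow> (\<exists>A\<in>flag_sets N E. I \<subseteq> A)"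
      by (simp add: T_def)
    also have "\<dots> \<longleftrightarrow> I \<in> flag_sets N E" using down[of _ I] by auto
    finally show ?thesis .
  qed
  have min: "(\<forall>M. M \<subset> v ` I \<longrightarrow> (\<exists>F\<in>T. M \<subseteq> F)) \<longleftrightarrow> (\<forall>J. J \<subset> I \<longrightarrow> J \<in> flag_sets N E)"
    if I: "I \<subseteq> N" for I
  proof -
    have "M \<subset> v ` I \<longleftrightarrow> (\<exists>J. J \<subset> I \<and> M = v ` J)" for M
    proof
      assume M: "M \<subset> v ` I"
      then obtain J where "J \<subseteq> I" "M = v ` J" by (meson psubset_imp_subset subset_imageE)
      then show "\<exists>J. J \<subset> I \<and> M = v ` J" using M by blast
    next
      assume "\<exists>J. J \<subset> I \<and> M = v ` J"
      then show "M \<subset> v ` I"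
        using image_strict_mono[OF inj_on_subset[OF inj I]] by metis
    qed
    then have "(\<forall>M. M \<subset> v ` I \<longrightarrow> (\<exists>F\<in>T. M \<subseteq> F)) \<longleftrightarrow> (\<forall>J. J \<subset> I \<longrightarrow> (\<exists>F\<in>T. v ` J \<subseteq> F))"
      by (simp only:) blast
    also have "\<dots> \<longleftrightarrow> (\<forall>J. J \<subset> I \<longrightarrow> J \<in> flag_sets N E)"
    proof -
      have "(\<exists>F\<in>T. v ` J \<subseteq> F) \<longleftrightarrow> J \<in> flag_sets N E" if "J \<subset> I" for J
        using covered[of J] that I by auto
      then show ?thesis by meson
    qed
    finally show ?thesis .
  qed
  have "minimal_non_faces P T =
      (`) v ` {I. I \<subseteq> N \<and> I \<notin> flag_sets N E \<and> (\<forall>J. J \<subset> I \<longrightarrow> J \<in> flag_sets N E)}" (is "_ = _ ` ?I")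
  proof (intro equalityI subsetI)
    fix M assume "M \<in> minimal_non_faces P T"
    then have M: "M \<subseteq> v ` N" "\<not> (\<exists>F\<in>T. M \<subseteq> F)" "\<forall>M'. M' \<subset> M \<longrightarrow> (\<exists>F\<in>T. M' \<subseteq> F)"
      unfolding minimal_non_faces_def non_face_def lat by blast+
    then obtain I where I: "I \<subseteq> N" "M = v ` I" by (meson subset_imageE)
    then have "I \<in> ?I" using M covered[OF I(1)] min[OF I(1)] by simp
    then show "M \<in> (`) v ` ?I" using I(2) by blast
  next
    fix M assume "M \<in> (`) v ` ?I"
    then obtain I where I: "I \<in> ?I" "M = v ` I" by blast
    then show "M \<in> minimal_non_faces P T"
      using covered[of I] min[of I]
      by (simp add: minimal_non_faces_def non_face_def lat image_mono)
  qed
  moreover have "?I = (\<lambda>(i, j). {i, j}) ` E"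
  proof (intro equalityI subsetI)
    fix I assume I: "I \<in> ?I"
    then obtain i j where ij: "(i, j) \<in> E" "{i, j} \<subseteq> I" by (auto simp: flag_sets_def)
    then have "{i, j} \<notin> flag_sets N E" by (auto simp: flag_sets_def)
    then have "\<not> {i, j} \<subset> I" using I by blast
    then have "I = {i, j}" using ij(2) by blast
    then show "I \<in> (\<lambda>(i, j). {i, j}) ` E" using ij(1) by force
  next
    fix I assume "I \<in> (\<lambda>(i, j). {i, j}) ` E"
    then obtain i j where ij: "(i, j) \<in> E" "I = {i, j}" by auto
    have "I \<subseteq> N" "I \<notin> flag_sets N E" using ij E by (auto simp: flag_sets_def)
    moreover have "J \<in> flag_sets N E" if J: "J \<subset> I" for J
    proof -
      have "\<exists>k. J \<subseteq> {k}" using J ij(2) by blast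
      then have "\<not> {a, b} \<subseteq> J" if "(a, b) \<in> E" for a b
        using E that by blast
      then show ?thesis using J \<open>I \<subseteq> N\<close> by (auto simp: flag_sets_def)
    qed
    ultimately show "I \<in> ?I" by blast
  qed
  ultimately show ?mnf by simp
qed

end

section \<open>Integer data in dimension four\<close>

type_synonym int4 = "int \<times> int \<times> int \<times> int"

fun dot :: "int4 \<Rightarrow> int4 \<Rightarrow> int" where
  "dot (a, b, c, d) (x, y, z, w) = a * x + b * y + c * z + d * w"

fun of_int4 :: "int4 \<Rightarrow> real^4" where
  "of_int4 (x, y, z, w) = pt (of_int x) (of_int y) (of_int z) (of_int w)"

lemma pt_nth:
  "pt x y z w $ 1 = x" "pt x y z w $ 2 = y" "pt x y z w $ 3 = z" "pt x y z w $ 4 = w"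
  by (simp_all add: pt_def vector_def)

lemma pt_eq_iff: "pt x y z w = pt x' y' z' w' \<longleftrightarrow> x = x' \<and> y = y' \<and> z = z' \<and> w = w'"
  by (auto simp: vec_eq_iff forall_4 pt_nth)

lemma pt_surj: "\<exists>x y z w. p = pt x y z w"
  by (rule exI[of _ "p $ 1"], rule exI[of _ "p $ 2"], rule exI[of _ "p $ 3"], rule exI[of _ "p $ 4"])
    (simp add: vec_eq_iff forall_4 pt_nth)

lemma inner_pt: "pt a b c d \<bullet> pt x y z w = a * x + b * y + c * z + d * w"
  by (simp add: inner_vec_def sum_4 pt_nth)

lemma inner_of_int4: "of_int4 a \<bullet> of_int4 p = of_int (dot a p)"
  by (cases a; cases p) (simp add: inner_pt)

lemma inj_of_int4: "inj of_int4"
proof (rule injI)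
  fix p q assume eq: "of_int4 p = of_int4 q"
  have "of_int4 p $ k = of_int4 q $ k" for k using eq by simp
  from this[of 1] this[of 2] this[of 3] this[of 4] show "p = q"
    by (cases p; cases q) (simp add: pt_nth)
qed

definition halfspaces :: "(int4 \<times> int) list \<Rightarrow> ((real^4) \<times> real) set" where
  "halfspaces hs = (\<lambda>(a, b). (of_int4 a, of_int b)) ` set hs"

section \<open>Families of index sets as lists of bit vectors\<close>

text \<open>
  A bit vector stands for the set of positions of its true entries.  Families of index sets are
  lists of bit vectors of a common length \<open>n\<close>, so that all set operations are evaluated by structural
  recursion.
\<close>

definition support :: "bool list \<Rightarrow> nat set" where
  "support s = {i. i < length s \<and> s ! i}"

lemma support_subset_length: "support s \<subseteq> {..<length s}"
  by (auto simp: support_def)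

lemma support_map: "support (map f xs) = {i. i < length xs \<and> f (xs ! i)}"
  by (auto simp: support_def)

lemma support_replicate: "support (replicate n b) = (if b then {..<n} else {})"
  by (auto simp: support_def)

lemma support_inter:
  "length s = length t \<Longrightarrow> support (map2 (\<and>) s t) = support s \<inter> support t"
  by (auto simp: support_def)

lemma support_insert: "i < length s \<Longrightarrow> support (s[i := True]) = insert i (support s)"
  by (auto simp: support_def nth_list_update split: if_splits)

lemma support_subset_iff:
  "length s = length t \<Longrightarrow> support s \<subseteq> support t \<longleftrightarrow> list_all2 (\<longrightarrow>) s t"
  by (auto simp: support_def list_all2_conv_all_nth)

fun tails :: "bool \<Rightarrow> bool list list \<Rightarrow> bool list list" where
  "tails b [] = []"
| "tails b (s # S) = (if hd s = b then tl s # tails b S else tails b S)"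

text \<open>
  Radix sort from the first position on.  It removes duplicates and brings a list into a form that
  depends on the set of its members only, as long as these all have length \<open>n\<close>, so that two
  families can be compared by comparing lists.
\<close>

fun radix :: "nat \<Rightarrow> bool list list \<Rightarrow> bool list list" where
  "radix n [] = []"
| "radix 0 (s # S) = [[]]"
| "radix (Suc n) (s # S) =
     map ((#) False) (radix n (tails False (s # S))) @ map ((#) True) (radix n (tails True (s # S)))"

lemma set_tails:
  "\<forall>s\<in>set S. length s = Suc n \<Longrightarrow> set (tails b S) = {s. b # s \<in> set S}"
proof (induction S)
  case (Cons s S)
  then obtain c t where "s = c # t" by (cases s) auto
  with Cons show ?case by auto
qed simp

lemma set_radix:
  "\<forall>s\<in>set S. length s = n \<Longrightarrow> set (radix n S) = set S"
proof (induction n S rule: radix.induct)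
  case (2 s S)
  then show ?case by auto
next
  case (3 n s S)
  let ?S = "s # S"
  have tails: "set (tails b ?S) = {t. b # t \<in> set ?S}" for b
    by (rule set_tails[OF 3(3)])
  have len: "\<forall>t\<in>set (tails b ?S). length t = n" for b
    unfolding tails using 3(3) by fastforce
  have "set (radix (Suc n) ?S) = (#) False ` {t. False # t \<in> set ?S} \<union> (#) True ` {t. True # t \<in> set ?S}"
    unfolding radix.simps set_append set_map 3(1)[OF len] 3(2)[OF len] tails ..
  also have "\<dots> = set ?S"
  proof (intro equalityI subsetI)
    fix u assume u: "u \<in> set ?S"
    then have "length u = Suc n" using 3(3) by blast
    then obtain b t where "u = b # t" by (cases u) auto
    then show "u \<in> (#) False ` {t. False # t \<in> set ?S} \<union> (#) True ` {t. True # t \<in> set ?S}"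
      using u by (cases b) (simp_all add: image_iff)
  qed blast
  finally show ?case .
qed simp

text \<open>
  The empty intersection is the polytope itself.  Sorting removes the repetitions, which would
  otherwise double the list with each further facet.
\<close>

fun meets :: "nat \<Rightarrow> bool list list \<Rightarrow> bool list list" where
  "meets n [] = [replicate n True]"
| "meets n (z # zs) = (let S = meets n zs in radix n (S @ map (map2 (\<and>) z) S))"

lemma set_meets:
  assumes "\<forall>z\<in>set zs. length z = n"
  shows "(\<forall>s\<in>set (meets n zs). length s = n) \<and>
    support ` set (meets n zs) = (\<lambda>Z. {i. i < n \<and> (\<forall>z\<in>Z. i \<in> support z)}) ` Pow (set zs)"
  using assms
proof (induction zs)
  case Nil
  then show ?case by (auto simp: support_replicate)
next
  case (Cons z zs)
  define S where "S = meets n zs"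
  define f where "f = (\<lambda>Z. {i. i < n \<and> (\<forall>z\<in>Z. i \<in> support z)})"
  have len: "\<forall>s\<in>set S. length s = n" and IH: "support ` set S = f ` Pow (set zs)"
    using Cons.IH Cons.prems unfolding S_def f_def by simp_all
  have z: "length z = n" using Cons.prems by simp
  have set: "set (meets n (z # zs)) = set S \<union> map2 (\<and>) z ` set S"
    unfolding meets.simps Let_def S_def[symmetric]
    using len z by (subst set_radix) auto
  have "support ` map2 (\<and>) z ` set S = (\<lambda>A. support z \<inter> A) ` support ` set S"
    unfolding image_image using len z by (intro image_cong) (auto simp: support_inter)
  also have "\<dots> = f ` insert z ` Pow (set zs)"
    unfolding IH image_image by (intro image_cong) (auto simp: f_def)
  finally have "support ` set (meets n (z # zs)) = f ` Pow (set (z # zs))"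
    unfolding set image_Un by (simp add: IH Pow_insert image_Un)
  moreover have "\<forall>s\<in>set (meets n (z # zs)). length s = n"
    unfolding set using len z by auto
  ultimately show ?case unfolding f_def by (intro conjI)
qed

text \<open>
  The leading all-false vector is the empty face, which need not be an intersection of the listed
  facets.
\<close>

definition facial_sets :: "(int4 \<times> int) list \<Rightarrow> int4 list \<Rightarrow> bool list list" where
  "facial_sets hs V = replicate (length V) False #
     meets (length V) (map (\<lambda>(a, b). map (\<lambda>p. dot a p = b) V) hs)"

lemma facial_sets_length: "\<forall>s\<in>set (facial_sets hs V). length s = length V"
proof -
  have "\<forall>z\<in>set (map (\<lambda>(a, b). map (\<lambda>p. dot a p = b) V) hs). length z = length V"
    by auto
  from set_meets[OF this, THEN conjunct1] show ?thesis
    unfolding facial_sets_def by simp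
qed

lemma facial_sets:
  assumes v: "\<And>i. i < length V \<Longrightarrow> v i = of_int4 (V ! i)"
    and P: "solutions (halfspaces hs) = cell v {..<length V}"
  shows "trivial_subdivision (cell v {..<length V}) = cell v ` support ` set (facial_sets hs V)"
proof -
  let ?n = "length V" and ?H = "halfspaces hs"
  let ?z = "\<lambda>(a, b). map (\<lambda>p. dot a p = b) V"
  have sub: "(\<lambda>(a, b). (of_int4 a, of_int b)) ` I \<subseteq> tight ?H (v i) \<longleftrightarrow> (\<forall>h\<in>I. i \<in> support (?z h))"
    if "I \<subseteq> set hs" "i < ?n" for I i
  proof -
    have "(of_int4 a, of_int b) \<in> tight ?H (v i) \<longleftrightarrow> i \<in> support (?z (a, b))" if "(a, b) \<in> set hs" for a b
    proof -
      have "(of_int4 a, of_int b) \<in> ?H"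
        unfolding halfspaces_def using that by (force intro: image_eqI[of _ _ "(a, b)"])
      then show ?thesis
        using \<open>i < ?n\<close> by (simp add: tight_def v inner_of_int4 support_map)
    qed
    then show ?thesis
      using that(1) unfolding image_subset_iff by (intro ball_cong) auto
  qed
  have "F \<in> trivial_subdivision (cell v {..<?n}) \<longleftrightarrow>
      F \<in> cell v ` insert {} ((\<lambda>I. {i. i < ?n \<and> (\<forall>h\<in>I. i \<in> support (?z h))}) ` Pow (set hs))" for F
  proof -
    have "F \<in> trivial_subdivision (cell v {..<?n}) \<longleftrightarrow>
        F = {} \<or> (\<exists>J\<subseteq>?H. F = convex hull {y \<in> v ` {..<?n}. J \<subseteq> tight ?H y})"
      unfolding trivial_subdivision_def P[symmetric] mem_Collect_eq
      by (rule face_of_solutions_iff[OF _ _ P[unfolded cell_def]]) (simp_all add: halfspaces_def)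
    also have "\<dots> \<longleftrightarrow> F = {} \<or> (\<exists>I\<subseteq>set hs. F = convex hull
        {y \<in> v ` {..<?n}. (\<lambda>(a, b). (of_int4 a, of_int b)) ` I \<subseteq> tight ?H y})"
    proof -
      have "J \<subseteq> ?H \<longleftrightarrow> (\<exists>I\<subseteq>set hs. J = (\<lambda>(a, b). (of_int4 a, of_int b)) ` I)" for J
        unfolding halfspaces_def by (rule subset_image_iff)
      then show ?thesis by (simp only:) blast
    qed
    also have "\<dots> \<longleftrightarrow> F = {} \<or> (\<exists>I\<subseteq>set hs. F = cell v {i. i < ?n \<and> (\<forall>h\<in>I. i \<in> support (?z h))})"
    proof -
      have "{y \<in> v ` {..<?n}. (\<lambda>(a, b). (of_int4 a, of_int b)) ` I \<subseteq> tight ?H y} =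
          v ` {i. i < ?n \<and> (\<forall>h\<in>I. i \<in> support (?z h))}" if "I \<subseteq> set hs" for I
        using sub[OF that] by auto
      then show ?thesis
        by (intro disj_cong ex_cong1 conj_cong refl) (simp add: cell_def)
    qed
    also have "\<dots> \<longleftrightarrow>
        F \<in> cell v ` insert {} ((\<lambda>I. {i. i < ?n \<and> (\<forall>h\<in>I. i \<in> support (?z h))}) ` Pow (set hs))"
      by (auto simp: cell_def)
    finally show ?thesis .
  qed
  moreover have "(\<lambda>I. {i. i < ?n \<and> (\<forall>h\<in>I. i \<in> support (?z h))}) ` Pow (set hs) =
      support ` set (meets ?n (map ?z hs))"
  proof -
    have "\<forall>z\<in>set (map ?z hs). length z = ?n" by auto
    from set_meets[OF this, THEN conjunct2]
    have "support ` set (meets ?n (map ?z hs)) =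
        (\<lambda>Z. {i. i < ?n \<and> (\<forall>z\<in>Z. i \<in> support z)}) ` Pow (?z ` set hs)"
      unfolding set_map .
    also have "Pow (?z ` set hs) = image ?z ` Pow (set hs)"
      by (rule image_Pow_surj[OF refl, symmetric])
    finally show ?thesis by (simp add: image_image)
  qed
  ultimately have "trivial_subdivision (cell v {..<?n}) =
      cell v ` insert {} (support ` set (meets ?n (map ?z hs)))"
    by (intro set_eqI) simp
  then show ?thesis
    unfolding facial_sets_def by (simp add: support_replicate)
qed

definition pull_list :: "nat \<Rightarrow> bool list list \<Rightarrow> bool list list" where
  "pull_list i S = (let star = [s \<leftarrow> S. s ! i]; rest = [s \<leftarrow> S. \<not> s ! i] in
     rest @ [s[i := True]. s \<leftarrow> rest, \<exists>t\<in>set star. list_all2 (\<longrightarrow>) s t])"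

lemma pull_list:
  assumes len: "\<forall>s\<in>set S. length s = n" and i: "i < n"
  shows "support ` set (pull_list i S) = pull_sets i (support ` set S)"
    and "\<forall>s\<in>set (pull_list i S). length s = n"
proof -
  let ?R = "{s \<in> set S. \<not> s ! i \<and> (\<exists>t\<in>set S. t ! i \<and> list_all2 (\<longrightarrow>) s t)}"
  have set: "set (pull_list i S) = {s \<in> set S. \<not> s ! i} \<union> (\<lambda>s. s[i := True]) ` ?R"
    by (auto simp: pull_list_def Let_def)
  have mem: "i \<in> support s \<longleftrightarrow> s ! i" if "s \<in> set S" for s
    using len i that by (simp add: support_def)
  have sub: "support s \<subseteq> support t \<longleftrightarrow> list_all2 (\<longrightarrow>) s t" if "s \<in> set S" "t \<in> set S" for s t
    using len that by (intro support_subset_iff) simp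
  have "support ` (\<lambda>s. s[i := True]) ` ?R = insert i ` support ` ?R"
    unfolding image_image using len i by (intro image_cong) (auto simp: support_insert)
  also have "support ` ?R = {B \<in> support ` set S. i \<notin> B \<and> (\<exists>A\<in>support ` set S. i \<in> A \<and> B \<subseteq> A)}"
    using mem sub by (auto intro!: imageI)
  finally show "support ` set (pull_list i S) = pull_sets i (support ` set S)"
    using mem unfolding set pull_sets_def image_Un by auto
  show "\<forall>s\<in>set (pull_list i S). length s = n"
    using len unfolding set by auto
qed

lemma fold_pull_list:
  assumes "\<forall>s\<in>set S. length s = n" "set is \<subseteq> {..<n}"
  shows "support ` set (fold pull_list is S) = fold pull_sets is (support ` set S)
    \<and> (\<forall>s\<in>set (fold pull_list is S). length s = n)"
  using assms
proof (induction "is" arbitrary: S)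
  case (Cons i "is")
  have S: "\<forall>s\<in>set S. length s = n" and i: "i < n" and "is": "set is \<subseteq> {..<n}"
    using Cons.prems by simp_all
  show ?case
    using Cons.IH[OF pull_list(2)[OF S i] "is"] pull_list(1)[OF S i] by simp
qed simp

text \<open>
  A member of the flag complex on \<open>n + 1\<close> points arises from one on the first \<open>n\<close> points; the new point
  \<open>n\<close> can join unless it forms a pair with a smaller point already present.  This supposes that each
  pair is listed with its smaller element first.
\<close>

fun flag_list :: "nat \<Rightarrow> (nat \<times> nat) list \<Rightarrow> bool list list" where
  "flag_list 0 E = [[]]"
| "flag_list (Suc n) E = (let S = flag_list n E; I = map fst (filter (\<lambda>e. snd e = n) E) in
     map (\<lambda>s. s @ [False]) S @ [s @ [True]. s \<leftarrow> S, \<forall>i\<in>set I. \<not> s ! i])"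

lemma set_flag_list:
  assumes "\<forall>(i, j)\<in>set E. i < j"
  shows "set (flag_list n E) = {s. length s = n \<and> (\<forall>(i, j)\<in>set E. j < n \<longrightarrow> \<not> (s ! i \<and> s ! j))}"
proof (induction n)
  case (Suc n)
  have snoc: "s @ [b] \<in> set (flag_list (Suc n) E) \<longleftrightarrow>
      s @ [b] \<in> {s. length s = Suc n \<and> (\<forall>(i, j)\<in>set E. j < Suc n \<longrightarrow> \<not> (s ! i \<and> s ! j))}" for s b
  proof -
    have "s @ [b] \<in> set (flag_list (Suc n) E) \<longleftrightarrow>
        s \<in> set (flag_list n E) \<and> (b \<longrightarrow> (\<forall>(i, j)\<in>set E. j = n \<longrightarrow> \<not> s ! i))"
      by (cases b) (auto simp: Let_def)
    also have "\<dots> \<longleftrightarrow> length s = n \<and>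
        (\<forall>(i, j)\<in>set E. (j < n \<longrightarrow> \<not> (s ! i \<and> s ! j)) \<and> (j = n \<and> b \<longrightarrow> \<not> s ! i))"
      unfolding Suc.IH by auto
    also have "\<dots> \<longleftrightarrow> length s = n \<and>
        (\<forall>(i, j)\<in>set E. j < Suc n \<longrightarrow> \<not> ((s @ [b]) ! i \<and> (s @ [b]) ! j))"
    proof (intro conj_cong refl ball_cong)
      fix e assume e: "e \<in> set E" and "length s = n"
      obtain i j where ij: "e = (i, j)" by (cases e)
      have "i < j" using assms e ij by auto
      then show "(case e of (i, j) \<Rightarrow> (j < n \<longrightarrow> \<not> (s ! i \<and> s ! j)) \<and> (j = n \<and> b \<longrightarrow> \<not> s ! i)) \<longleftrightarrow>
          (case e of (i, j) \<Rightarrow> j < Suc n \<longrightarrow> \<not> ((s @ [b]) ! i \<and> (s @ [b]) ! j))"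
        using \<open>length s = n\<close> ij by (auto simp: nth_append less_Suc_eq)
    qed
    finally show ?thesis by simp
  qed
  have "[] \<notin> set (flag_list (Suc n) E)" by (auto simp: Let_def)
  then have "s \<in> set (flag_list (Suc n) E) \<longleftrightarrow>
      s \<in> {s. length s = Suc n \<and> (\<forall>(i, j)\<in>set E. j < Suc n \<longrightarrow> \<not> (s ! i \<and> s ! j))}" for s
    using snoc by (cases s rule: rev_cases) auto
  then show ?case by blast
qed auto

lemma ex_support:
  assumes "A \<subseteq> {..<n}"
  obtains s where "length s = n" "support s = A"
proof
  show "length (map (\<lambda>i. i \<in> A) [0..<n]) = n" by simp
  show "support (map (\<lambda>i. i \<in> A) [0..<n]) = A"
    using assms by (auto simp: support_map)
qed

lemma support_flag_list:
  assumes "\<forall>(i, j)\<in>set E. i < j \<and> j < n"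
  shows "support ` set (flag_list n E) = flag_sets {..<n} (set E)"
proof -
  have flag: "s \<in> set (flag_list n E) \<longleftrightarrow> support s \<in> flag_sets {..<n} (set E)" if "length s = n" for s
  proof -
    have "support s \<subseteq> {..<n}" using that support_subset_length by blast
    moreover have "{i, j} \<subseteq> support s \<longleftrightarrow> s ! i \<and> s ! j" if "(i, j) \<in> set E" for i j
      using assms that \<open>length s = n\<close> by (force simp: support_def)
    moreover have "\<forall>(i, j)\<in>set E. i < j" using assms by auto
    ultimately show ?thesis
      using assms \<open>length s = n\<close> by (fastforce simp: set_flag_list flag_sets_def)
  qed
  have "length s = n" if "s \<in> set (flag_list n E)" for s
    using that assms by (subst (asm) set_flag_list) auto
  then have "support ` set (flag_list n E) \<subseteq> flag_sets {..<n} (set E)"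
    using flag by auto
  moreover have "flag_sets {..<n} (set E) \<subseteq> support ` set (flag_list n E)"
  proof
    fix A assume A: "A \<in> flag_sets {..<n} (set E)"
    then obtain s where "length s = n" "support s = A"
      using ex_support[of A n] by (auto simp: flag_sets_def)
    then show "A \<in> support ` set (flag_list n E)" using A flag[of s] by blast
  qed
  ultimately show ?thesis by (rule antisym)
qed

section \<open>A computable certificate for a pulled triangulation\<close>

text \<open>
  The last two conditions are the combinatorial core: the family obtained by pulling is the flag
  complex of \<open>E\<close>, and its members with five elements are those listed in \<open>M\<close>.
\<close>

definition certificate ::
  "(int4 \<times> int) list \<Rightarrow> int4 list \<Rightarrow> nat list \<Rightarrow> nat list list \<Rightarrow> (nat \<times> nat) list \<Rightarrow> bool" where
  "certificate hs V is M E \<longleftrightarrow> (let n = length V; F = flag_list n E in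
     distinct V \<and> (\<forall>(x, y, z, w)\<in>set V. \<forall>c\<in>set [x, y, z, w]. c = 0 \<or> c = 1) \<and>
     (\<forall>p\<in>set V. \<forall>(a, b)\<in>set hs. dot a p \<le> b) \<and>
     (\<forall>i\<in>set is. i < n) \<and> (\<forall>I\<in>set M. \<forall>i\<in>set I. i < n) \<and> (\<forall>(i, j)\<in>set E. i < j \<and> j < n) \<and>
     radix n (fold pull_list is (facial_sets hs V)) = radix n F \<and>
     radix n [s \<leftarrow> F. length (filter id s) = 5] = radix n (map (\<lambda>I. map (\<lambda>i. i \<in> set I) [0..<n]) M))"

text \<open>
  Besides the certificate, the geometric input is that the inequalities describe a bounded set \<open>P\<close>
  and that each point of \<open>P\<close> has a listed point tight wherever it is tight.
\<close>

theorem pulled_triangulation: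
  assumes cert: "certificate hs V is M E"
    and v_def: "\<And>i. v i = map of_int4 V ! i"
    and P: "\<And>x y z w. pt x y z w \<in> P \<longleftrightarrow> (\<forall>(a, b)\<in>set hs. of_int4 a \<bullet> pt x y z w \<le> of_int b)"
    and bounded: "bounded P"
    and vertex: "\<And>x y z w. pt x y z w \<in> P \<Longrightarrow>
      \<exists>p\<in>set V. \<forall>(a, b)\<in>set hs. of_int4 a \<bullet> pt x y z w = of_int b \<longrightarrow> dot a p = b"
  shows "let T = pulling P (map v is) in
      lattice_triangulation_of T P \<and>
      full_cells T = cell v ` set ` set M \<and>
      minimal_non_faces P T = (`) v ` (\<lambda>(i, j). {i, j}) ` set E"
proof -
  have v: "v i = of_int4 (V ! i)" if "i < length V" for i
    using that by (simp add: v_def)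
  define n where "n = length V"
  define F where "F = flag_list n E"
  define S where "S = fold pull_list is (facial_sets hs V)"
  note cert = cert[unfolded certificate_def Let_def, folded n_def, folded F_def S_def]
  have distinct: "distinct V"
    and zo: "\<forall>(x, y, z, w)\<in>set V. \<forall>c\<in>set [x, y, z, w]. c = 0 \<or> c = 1"
    and ineq: "\<forall>p\<in>set V. \<forall>(a, b)\<in>set hs. dot a p \<le> b"
    and is_less: "\<forall>i\<in>set is. i < n" and M_less: "\<forall>I\<in>set M. \<forall>i\<in>set I. i < n"
    and E_less: "\<forall>(i, j)\<in>set E. i < j \<and> j < n"
    and SF: "radix n S = radix n F"
    and FM: "radix n [s \<leftarrow> F. length (filter id s) = 5] =
      radix n (map (\<lambda>I. map (\<lambda>i. i \<in> set I) [0..<n]) M)"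
    using cert by - (elim conjE, assumption)+
  have is_sub: "set is \<subseteq> {..<n}" using is_less by blast
  have v_image: "v ` {..<n} = of_int4 ` set V"
  proof -
    have "set V = (!) V ` {..<n}" by (auto simp: n_def set_conv_nth)
    then show ?thesis using v by (simp add: image_image n_def)
  qed
  have PH: "P = solutions (halfspaces hs)"
  proof (rule set_eqI)
    fix p
    obtain x y z w where "p = pt x y z w" using pt_surj by blast
    then show "p \<in> P \<longleftrightarrow> p \<in> solutions (halfspaces hs)"
      using P[of x y z w] by (auto simp: solutions_def halfspaces_def simp del: of_int4.simps)
  qed
  have PV: "solutions (halfspaces hs) = cell v {..<n}"
    unfolding cell_def v_image
  proof (rule solutions_eq_convex_hull)
    show "finite (halfspaces hs)" by (simp add: halfspaces_def)
    show "of_int4 ` set V \<subseteq> solutions (halfspaces hs)"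
    proof (rule image_subsetI)
      fix p assume "p \<in> set V"
      then have "\<forall>(a, b)\<in>set hs. dot a p \<le> b" using ineq by blast
      then show "of_int4 p \<in> solutions (halfspaces hs)"
        by (auto simp: solutions_def halfspaces_def inner_of_int4 simp del: of_int4.simps)
    qed
    show "bounded (solutions (halfspaces hs))" using bounded PH by simp
    fix q assume q: "q \<in> solutions (halfspaces hs)"
    obtain x y z w where xyzw: "q = pt x y z w" using pt_surj by blast
    then obtain p where p: "p \<in> set V"
        "\<forall>(a, b)\<in>set hs. of_int4 a \<bullet> q = of_int b \<longrightarrow> dot a p = b"
      using vertex[of x y z w] q PH by blast
    then have "tight (halfspaces hs) q \<subseteq> tight (halfspaces hs) (of_int4 p)"
      by (auto simp: tight_def halfspaces_def inner_of_int4 simp del: of_int4.simps)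
    then show "\<exists>y\<in>of_int4 ` set V. tight (halfspaces hs) q \<subseteq> tight (halfspaces hs) y"
      using p(1) by blast
  qed
  interpret zero_one_points v "{..<n}"
  proof
    show "inj_on v {..<n}"
    proof (rule inj_onI)
      fix i j assume ij: "i \<in> {..<n}" "j \<in> {..<n}" "v i = v j"
      then have "V ! i = V ! j" using v injD[OF inj_of_int4] by (simp add: n_def)
      then show "i = j" using ij distinct by (simp add: n_def nth_eq_iff_index_eq)
    qed
    show "v ` {..<n} \<subseteq> zero_one"
      unfolding v_image
    proof (rule image_subsetI)
      fix p assume p: "p \<in> set V"
      obtain x y z w where xyzw: "p = (x, y, z, w)" by (cases p)
      have "\<forall>c\<in>set [x, y, z, w]. c = 0 \<or> c = 1"
        using bspec[OF zo p] unfolding xyzw by simp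
      then show "of_int4 p \<in> zero_one"
        by (simp add: xyzw zero_one_def forall_4 pt_nth)
    qed
  qed simp
  have len: "\<forall>s\<in>set (facial_sets hs V). length s = n"
    using facial_sets_length by (simp add: n_def)
  have S: "support ` set S = fold pull_sets is (support ` set (facial_sets hs V))"
    and lenS: "\<forall>s\<in>set S. length s = n"
    unfolding S_def using fold_pull_list[OF len is_sub] by simp_all
  have lenF: "\<forall>s\<in>set F. length s = n"
  proof -
    have "\<forall>(i, j)\<in>set E. i < j" using E_less by blast
    then show ?thesis by (simp add: F_def set_flag_list)
  qed
  have F: "support ` set F = flag_sets {..<n} (set E)"
    unfolding F_def by (rule support_flag_list[OF E_less])
  have "set S = set F"
    using SF set_radix[OF lenS] set_radix[OF lenF] by simp
  have P_cell: "P = cell v {..<n}" using PH PV by simp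
  have poly: "polytope P"
    unfolding P_cell cell_def by (simp add: polytope_convex_hull)
  have "trivial_subdivision P = cell v ` support ` set (facial_sets hs V)"
    unfolding P_cell n_def by (rule facial_sets[OF v PV[unfolded n_def]])
  moreover have "support ` set (facial_sets hs V) \<subseteq> Pow {..<n}"
    using len support_subset_length by fastforce
  ultimately have T: "pulling P (map v is) = cell v ` flag_sets {..<n} (set E)"
    using pulling_cells[OF poly _ _ is_sub, of "support ` set (facial_sets hs V)"]
    by (simp add: S[symmetric] \<open>set S = set F\<close> F)
  have K: "polytopal_complex (cell v ` flag_sets {..<n} (set E))"
    and U: "\<Union>(cell v ` flag_sets {..<n} (set E)) = P"
    using pulling_complex[OF poly, of "map v is"] unfolding T by simp_all
  have E_in: "\<forall>(i, j)\<in>set E. i \<in> {..<n} \<and> j \<in> {..<n} \<and> i \<noteq> j"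
    using E_less by fastforce
  note flag = flag_triangulation[OF K U P_cell E_in]
  have "full_cells (cell v ` flag_sets {..<n} (set E)) =
      cell v ` {A \<in> flag_sets {..<n} (set E). card A = 5}"
    using flag(2)[of 4] by (simp add: full_cells_def)
  also have "{A \<in> flag_sets {..<n} (set E). card A = 5} = support ` set [s \<leftarrow> F. length (filter id s) = 5]"
  proof -
    have "length (filter id s) = card (support s)" for s
      by (simp add: length_filter_conv_card support_def)
    then show ?thesis unfolding F[symmetric] by auto
  qed
  also have "set [s \<leftarrow> F. length (filter id s) = 5] = set (map (\<lambda>I. map (\<lambda>i. i \<in> set I) [0..<n]) M)"
  proof -
    have "\<forall>s\<in>set [s \<leftarrow> F. length (filter id s) = 5]. length s = n" using lenF by simp
    moreover have "\<forall>s\<in>set (map (\<lambda>I. map (\<lambda>i. i \<in> set I) [0..<n]) M). length s = n" by auto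
    ultimately show ?thesis
      using arg_cong[OF FM, of set] by (simp only: set_radix)
  qed
  also have "support ` \<dots> = set ` set M"
  proof -
    have "support (map (\<lambda>i. i \<in> set I) [0..<n]) = set I" if "I \<in> set M" for I
      using M_less that by (auto simp: support_map)
    then show ?thesis by (simp add: image_image)
  qed
  finally show ?thesis
    unfolding T Let_def using flag(1,3) by (intro conjI)
qed

section \<open>The five polytopes\<close>

lemma bounded_in_unit_cube:
  assumes "\<And>x y z w. pt x y z w \<in> P \<Longrightarrow>
    0 \<le> x \<and> x \<le> 1 \<and> 0 \<le> y \<and> y \<le> 1 \<and> 0 \<le> z \<and> z \<le> 1 \<and> 0 \<le> w \<and> w \<le> 1"
  shows "bounded P"
proof (rule bounded_subset[OF bounded_cbox])
  show "P \<subseteq> cbox 0 1"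
  proof
    fix p assume "p \<in> P"
    moreover obtain x y z w where "p = pt x y z w" using pt_surj by blast
    ultimately show "p \<in> cbox 0 1"
      using assms[of x y z w] by (simp add: mem_box_cart forall_4 pt_nth)
  qed
qed

text \<open>
  In each case below, the inequalities are listed with all variables on the left, as \<open>a \<bullet> p \<le> b\<close>.  The
  existence of a vertex in the smallest face of a given point is a propositional combination of
  linear inequalities in four real unknowns.
\<close>

definition rows_VIc :: "(int4 \<times> int) list" where
  "rows_VIc =
    [((-1, 0, 0, 0), 0), ((0, -1, 0, 0), 0), ((0, 0, -1, 0), 0), ((0, 0, 0, -1), 0),
     ((1, 0, -1, -1), 0), ((0, 0, 1, 1), 1), ((-1, -1, 0, 1), 0), ((1, 1, 0, 0), 1)]"

definition points_VIc :: "int4 list" where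
  "points_VIc =
    [(0, 0, 0, 0), (0, 0, 1, 0), (1, 0, 1, 0), (1, 0, 0, 1), (0, 1, 0, 0), (0, 1, 1, 0),
     (0, 1, 0, 1)]"

lemma certificate_VIc:
  "certificate rows_VIc points_VIc [5]
    [[0, 1, 2, 3, 5], [0, 3, 4, 5, 6], [0, 1, 3, 5, 6], [0, 2, 3, 4, 5]]
    [(1, 4), (2, 6)]"
  by code_simp

lemma triangulation_VIc:
  "let T = pulling nabla_VIc [v_VIc 5] in
     lattice_triangulation_of T nabla_VIc \<and>
     full_cells T = cell v_VIc `
       {{0, 1, 2, 3, 5}, {0, 3, 4, 5, 6}, {0, 1, 3, 5, 6}, {0, 2, 3, 4, 5}} \<and>
     minimal_non_faces nabla_VIc T = (`) v_VIc `
       {{1, 4}, {2, 6}}"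
proof -
  have P: "pt x y z w \<in> nabla_VIc \<longleftrightarrow>
      (\<forall>(a, b)\<in>set rows_VIc. of_int4 a \<bullet> pt x y z w \<le> of_int b)" for x y z w
    by (auto simp: nabla_VIc_def rows_VIc_def pt_eq_iff inner_pt)
  have "v_VIc i = map of_int4 points_VIc ! i" for i
    by (simp add: v_VIc_def points_VIc_def)
  moreover have "bounded nabla_VIc"
    by (rule bounded_in_unit_cube) (auto simp: nabla_VIc_def pt_eq_iff)
  moreover have "\<exists>p\<in>set points_VIc. \<forall>(a, b)\<in>set rows_VIc.
      of_int4 a \<bullet> pt x y z w = of_int b \<longrightarrow> dot a p = b"
    if "pt x y z w \<in> nabla_VIc" for x y z w
    using that
    by (simp add: nabla_VIc_def rows_VIc_def points_VIc_def pt_eq_iff inner_pt) argo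
  ultimately show ?thesis
    using pulled_triangulation[OF certificate_VIc _ P] by simp
qed

definition rows_VIIb :: "(int4 \<times> int) list" where
  "rows_VIIb =
    [((-1, 0, 0, 0), 0), ((1, 0, 0, 0), 1), ((0, -1, 0, 0), 0), ((0, 1, 0, 0), 1),
     ((0, 0, -1, 0), 0), ((0, 0, 0, -1), 0), ((0, 0, 1, 1), 1), ((-1, -1, 1, 1), 0),
     ((1, 1, -1, 0), 1)]"

definition points_VIIb :: "int4 list" where
  "points_VIIb =
    [(0, 0, 0, 0), (1, 0, 0, 0), (0, 1, 0, 0), (1, 0, 1, 0), (0, 1, 1, 0), (1, 1, 1, 0),
     (1, 0, 0, 1), (0, 1, 0, 1)]"

lemma certificate_VIIb:
  "certificate rows_VIIb points_VIIb [0, 4, 7]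
    [[0, 1, 3, 5, 6], [0, 3, 4, 5, 6], [0, 4, 5, 6, 7], [0, 1, 5, 6, 7], [0, 1, 2, 5, 7],
     [0, 2, 4, 5, 7]]
    [(2, 6), (3, 7), (1, 4), (2, 3)]"
  by code_simp

lemma triangulation_VIIb:
  "let T = pulling nabla_VIIb [v_VIIb 0, v_VIIb 4, v_VIIb 7] in
     lattice_triangulation_of T nabla_VIIb \<and>
     full_cells T = cell v_VIIb `
       {{0, 1, 3, 5, 6}, {0, 3, 4, 5, 6}, {0, 4, 5, 6, 7}, {0, 1, 5, 6, 7},
        {0, 1, 2, 5, 7}, {0, 2, 4, 5, 7}} \<and>
     minimal_non_faces nabla_VIIb T = (`) v_VIIb `
       {{2, 6}, {3, 7}, {1, 4}, {2, 3}}"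
proof -
  have P: "pt x y z w \<in> nabla_VIIb \<longleftrightarrow>
      (\<forall>(a, b)\<in>set rows_VIIb. of_int4 a \<bullet> pt x y z w \<le> of_int b)" for x y z w
    by (auto simp: nabla_VIIb_def rows_VIIb_def pt_eq_iff inner_pt)
  have "v_VIIb i = map of_int4 points_VIIb ! i" for i
    by (simp add: v_VIIb_def points_VIIb_def)
  moreover have "bounded nabla_VIIb"
    by (rule bounded_in_unit_cube) (auto simp: nabla_VIIb_def pt_eq_iff)
  moreover have "\<exists>p\<in>set points_VIIb. \<forall>(a, b)\<in>set rows_VIIb.
      of_int4 a \<bullet> pt x y z w = of_int b \<longrightarrow> dot a p = b"
    if "pt x y z w \<in> nabla_VIIb" for x y z w
    using that
    by (simp add: nabla_VIIb_def rows_VIIb_def points_VIIb_def pt_eq_iff inner_pt) argo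
  ultimately show ?thesis
    using pulled_triangulation[OF certificate_VIIb _ P] by simp
qed

definition rows_VIIIa :: "(int4 \<times> int) list" where
  "rows_VIIIa =
    [((-1, 0, 0, 0), 0), ((1, 0, 0, 0), 1), ((0, -1, 0, 0), 0), ((0, 1, 0, 0), 1),
     ((0, 0, -1, 0), 0), ((0, 0, 1, 0), 1), ((0, 0, 0, -1), 0), ((0, 0, 0, 1), 1),
     ((0, 1, -1, -1), 0), ((0, -1, 1, 1), 1), ((1, 0, -1, -1), 0), ((-1, 0, 1, 1), 1)]"

definition points_VIIIa :: "int4 list" where
  "points_VIIIa =
    [(0, 0, 0, 0), (0, 0, 1, 0), (1, 0, 1, 0), (0, 1, 1, 0), (0, 0, 0, 1), (1, 0, 0, 1),
     (0, 1, 0, 1), (1, 1, 1, 1), (1, 1, 1, 0), (1, 1, 0, 1)]"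

lemma certificate_VIIIa:
  "certificate rows_VIIIa points_VIIIa [0, 2, 6]
    [[0, 2, 7, 8, 9], [0, 2, 5, 7, 9], [0, 2, 3, 7, 8], [0, 1, 2, 3, 7], [0, 2, 4, 5, 7],
     [0, 1, 2, 4, 7], [0, 6, 7, 8, 9], [0, 3, 6, 7, 8], [0, 5, 6, 7, 9], [0, 4, 5, 6, 7],
     [0, 1, 3, 6, 7], [0, 1, 4, 6, 7]]
    [(1, 5), (1, 8), (1, 9), (2, 6), (3, 4), (3, 5), (3, 9), (4, 8), (4, 9), (5, 8)]"
  by code_simp

lemma triangulation_VIIIa:
  "let T = pulling nabla_VIIIa [v_VIIIa 0, v_VIIIa 2, v_VIIIa 6] in
     lattice_triangulation_of T nabla_VIIIa \<and>
     full_cells T = cell v_VIIIa `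
       {{0, 2, 7, 8, 9}, {0, 2, 5, 7, 9}, {0, 2, 3, 7, 8}, {0, 1, 2, 3, 7},
        {0, 2, 4, 5, 7}, {0, 1, 2, 4, 7}, {0, 6, 7, 8, 9}, {0, 3, 6, 7, 8},
        {0, 5, 6, 7, 9}, {0, 4, 5, 6, 7}, {0, 1, 3, 6, 7}, {0, 1, 4, 6, 7}} \<and>
     minimal_non_faces nabla_VIIIa T = (`) v_VIIIa `
       {{1, 5}, {1, 8}, {1, 9}, {2, 6}, {3, 4}, {3, 5}, {3, 9}, {4, 8}, {4, 9}, {5, 8}}"
proof -
  have P: "pt x y z w \<in> nabla_VIIIa \<longleftrightarrow>
      (\<forall>(a, b)\<in>set rows_VIIIa. of_int4 a \<bullet> pt x y z w \<le> of_int b)" for x y z w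
    by (auto simp: nabla_VIIIa_def rows_VIIIa_def pt_eq_iff inner_pt)
  have "v_VIIIa i = map of_int4 points_VIIIa ! i" for i
    by (simp add: v_VIIIa_def points_VIIIa_def)
  moreover have "bounded nabla_VIIIa"
    by (rule bounded_in_unit_cube) (auto simp: nabla_VIIIa_def pt_eq_iff)
  moreover have "\<exists>p\<in>set points_VIIIa. \<forall>(a, b)\<in>set rows_VIIIa.
      of_int4 a \<bullet> pt x y z w = of_int b \<longrightarrow> dot a p = b"
    if "pt x y z w \<in> nabla_VIIIa" for x y z w
    using that
    by (simp add: nabla_VIIIa_def rows_VIIIa_def points_VIIIa_def pt_eq_iff inner_pt) argo
  ultimately show ?thesis
    using pulled_triangulation[OF certificate_VIIIa _ P] by simp
qed

definition rows_IXa :: "(int4 \<times> int) list" where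
  "rows_IXa =
    [((-1, 0, 0, 0), 0), ((1, 0, 0, 0), 1), ((0, -1, 0, 0), 0), ((0, 1, 0, 0), 1),
     ((0, 0, -1, 0), 0), ((0, 0, 1, 0), 1), ((0, 0, 0, -1), 0), ((0, 0, 0, 1), 1),
     ((1, 1, -1, -1), 0), ((-1, -1, 1, 1), 1)]"

definition points_IXa :: "int4 list" where
  "points_IXa =
    [(0, 0, 0, 0), (0, 0, 0, 1), (1, 0, 0, 1), (0, 1, 0, 1), (0, 0, 1, 0), (1, 0, 1, 0),
     (0, 1, 1, 0), (1, 0, 1, 1), (0, 1, 1, 1), (1, 1, 1, 1)]"

lemma certificate_IXa:
  "certificate rows_IXa points_IXa [0, 1, 6]
    [[0, 2, 5, 7, 9], [0, 3, 6, 8, 9], [0, 1, 4, 7, 8], [0, 1, 2, 7, 9], [0, 1, 7, 8, 9],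
     [0, 1, 2, 3, 9], [0, 1, 3, 8, 9], [0, 5, 6, 7, 9], [0, 6, 7, 8, 9], [0, 4, 5, 6, 7],
     [0, 4, 6, 7, 8]]
    [(4, 9), (3, 7), (1, 6), (3, 4), (3, 5), (5, 8), (2, 8), (2, 6), (1, 5), (2, 4)]"
  by code_simp

lemma triangulation_IXa:
  "let T = pulling nabla_IXa [v_IXa 0, v_IXa 1, v_IXa 6] in
     lattice_triangulation_of T nabla_IXa \<and>
     full_cells T = cell v_IXa `
       {{0, 2, 5, 7, 9}, {0, 3, 6, 8, 9}, {0, 1, 4, 7, 8}, {0, 1, 2, 7, 9},
        {0, 1, 7, 8, 9}, {0, 1, 2, 3, 9}, {0, 1, 3, 8, 9}, {0, 5, 6, 7, 9},
        {0, 6, 7, 8, 9}, {0, 4, 5, 6, 7}, {0, 4, 6, 7, 8}} \<and>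
     minimal_non_faces nabla_IXa T = (`) v_IXa `
       {{4, 9}, {3, 7}, {1, 6}, {3, 4}, {3, 5}, {5, 8}, {2, 8}, {2, 6}, {1, 5}, {2, 4}}"
proof -
  have P: "pt x y z w \<in> nabla_IXa \<longleftrightarrow>
      (\<forall>(a, b)\<in>set rows_IXa. of_int4 a \<bullet> pt x y z w \<le> of_int b)" for x y z w
    by (auto simp: nabla_IXa_def rows_IXa_def pt_eq_iff inner_pt)
  have "v_IXa i = map of_int4 points_IXa ! i" for i
    by (simp add: v_IXa_def points_IXa_def)
  moreover have "bounded nabla_IXa"
    by (rule bounded_in_unit_cube) (auto simp: nabla_IXa_def pt_eq_iff)
  moreover have "\<exists>p\<in>set points_IXa. \<forall>(a, b)\<in>set rows_IXa.
      of_int4 a \<bullet> pt x y z w = of_int b \<longrightarrow> dot a p = b"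
    if "pt x y z w \<in> nabla_IXa" for x y z w
    using that
    by (simp add: nabla_IXa_def rows_IXa_def points_IXa_def pt_eq_iff inner_pt) argo
  ultimately show ?thesis
    using pulled_triangulation[OF certificate_IXa _ P] by simp
qed

definition rows_Xa :: "(int4 \<times> int) list" where
  "rows_Xa =
    [((-1, 0, 0, 0), 0), ((1, 0, 0, 0), 1), ((0, -1, 0, 0), 0), ((0, 1, 0, 0), 1),
     ((0, 0, -1, 0), 0), ((0, 0, 1, 0), 1), ((0, 0, 0, -1), 0), ((1, -1, -1, 0), 0),
     ((-1, 1, 1, 1), 1)]"

definition points_Xa :: "int4 list" where
  "points_Xa =
    [(0, 0, 0, 0), (0, 1, 0, 0), (0, 0, 1, 0), (0, 0, 0, 1), (1, 1, 0, 0), (1, 1, 0, 1),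
     (1, 0, 1, 0), (1, 0, 1, 1), (1, 1, 1, 0)]"

lemma certificate_Xa:
  "certificate rows_Xa points_Xa [0, 6, 3]
    [[0, 1, 4, 5, 8], [0, 5, 6, 7, 8], [0, 4, 5, 6, 8], [0, 2, 6, 7, 8], [0, 3, 5, 7, 8],
     [0, 1, 3, 5, 8], [0, 2, 3, 7, 8], [0, 1, 2, 3, 8]]
    [(2, 5), (3, 4), (3, 6), (1, 7), (4, 7), (1, 6), (2, 4)]"
  by code_simp

lemma triangulation_Xa:
  "let T = pulling nabla_Xa [v_Xa 0, v_Xa 6, v_Xa 3] in
     lattice_triangulation_of T nabla_Xa \<and>
     full_cells T = cell v_Xa `
       {{0, 1, 4, 5, 8}, {0, 5, 6, 7, 8}, {0, 4, 5, 6, 8}, {0, 2, 6, 7, 8},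
        {0, 3, 5, 7, 8}, {0, 1, 3, 5, 8}, {0, 2, 3, 7, 8}, {0, 1, 2, 3, 8}} \<and>
     minimal_non_faces nabla_Xa T = (`) v_Xa `
       {{2, 5}, {3, 4}, {3, 6}, {1, 7}, {4, 7}, {1, 6}, {2, 4}}"
proof -
  have P: "pt x y z w \<in> nabla_Xa \<longleftrightarrow>
      (\<forall>(a, b)\<in>set rows_Xa. of_int4 a \<bullet> pt x y z w \<le> of_int b)" for x y z w
    by (auto simp: nabla_Xa_def rows_Xa_def pt_eq_iff inner_pt)
  have "v_Xa i = map of_int4 points_Xa ! i" for i
    by (simp add: v_Xa_def points_Xa_def)
  moreover have "bounded nabla_Xa"
    by (rule bounded_in_unit_cube) (auto simp: nabla_Xa_def pt_eq_iff)
  moreover have "\<exists>p\<in>set points_Xa. \<forall>(a, b)\<in>set rows_Xa.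
      of_int4 a \<bullet> pt x y z w = of_int b \<longrightarrow> dot a p = b"
    if "pt x y z w \<in> nabla_Xa" for x y z w
    using that
    by (simp add: nabla_Xa_def rows_Xa_def points_Xa_def pt_eq_iff inner_pt) argo
  ultimately show ?thesis
    using pulled_triangulation[OF certificate_Xa _ P] by simp
qed

theorem proposition8p4:
  shows
    "(let T = pulling nabla_VIc [v_VIc 5] in
        lattice_triangulation_of T nabla_VIc \<and>
        full_cells T = cell v_VIc `
          {{0, 1, 2, 3, 5}, {0, 3, 4, 5, 6}, {0, 1, 3, 5, 6}, {0, 2, 3, 4, 5}} \<and>
        minimal_non_faces nabla_VIc T = (`) v_VIc `
          {{1, 4}, {2, 6}}) \<and>
     (let T = pulling nabla_VIIb [v_VIIb 0, v_VIIb 4, v_VIIb 7] in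
        lattice_triangulation_of T nabla_VIIb \<and>
        full_cells T = cell v_VIIb `
          {{0, 1, 3, 5, 6}, {0, 3, 4, 5, 6}, {0, 4, 5, 6, 7}, {0, 1, 5, 6, 7},
           {0, 1, 2, 5, 7}, {0, 2, 4, 5, 7}} \<and>
        minimal_non_faces nabla_VIIb T = (`) v_VIIb `
          {{2, 6}, {3, 7}, {1, 4}, {2, 3}}) \<and>
     (let T = pulling nabla_VIIIa [v_VIIIa 0, v_VIIIa 2, v_VIIIa 6] in
        lattice_triangulation_of T nabla_VIIIa \<and>
        full_cells T = cell v_VIIIa `
          {{0, 2, 7, 8, 9}, {0, 2, 5, 7, 9}, {0, 2, 3, 7, 8}, {0, 1, 2, 3, 7},
           {0, 2, 4, 5, 7}, {0, 1, 2, 4, 7}, {0, 6, 7, 8, 9}, {0, 3, 6, 7, 8},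
           {0, 5, 6, 7, 9}, {0, 4, 5, 6, 7}, {0, 1, 3, 6, 7}, {0, 1, 4, 6, 7}} \<and>
        minimal_non_faces nabla_VIIIa T = (`) v_VIIIa `
          {{1, 5}, {1, 8}, {1, 9}, {2, 6}, {3, 4}, {3, 5},
           {3, 9}, {4, 8}, {4, 9}, {5, 8}}) \<and>
     (let T = pulling nabla_IXa [v_IXa 0, v_IXa 1, v_IXa 6] in
        lattice_triangulation_of T nabla_IXa \<and>
        full_cells T = cell v_IXa `
          {{0, 2, 5, 7, 9}, {0, 3, 6, 8, 9}, {0, 1, 4, 7, 8}, {0, 1, 2, 7, 9},
           {0, 1, 7, 8, 9}, {0, 1, 2, 3, 9}, {0, 1, 3, 8, 9}, {0, 5, 6, 7, 9},
           {0, 6, 7, 8, 9}, {0, 4, 5, 6, 7}, {0, 4, 6, 7, 8}} \<and>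
        minimal_non_faces nabla_IXa T = (`) v_IXa `
          {{4, 9}, {3, 7}, {1, 6}, {3, 4}, {3, 5}, {5, 8},
           {2, 8}, {2, 6}, {1, 5}, {2, 4}}) \<and>
     (let T = pulling nabla_Xa [v_Xa 0, v_Xa 6, v_Xa 3] in
        lattice_triangulation_of T nabla_Xa \<and>
        full_cells T = cell v_Xa `
          {{0, 1, 4, 5, 8}, {0, 5, 6, 7, 8}, {0, 4, 5, 6, 8}, {0, 2, 6, 7, 8},
           {0, 3, 5, 7, 8}, {0, 1, 3, 5, 8}, {0, 2, 3, 7, 8}, {0, 1, 2, 3, 8}} \<and>
        minimal_non_faces nabla_Xa T = (`) v_Xa `
          {{2, 5}, {3, 4}, {3, 6}, {1, 7}, {4, 7}, {1, 6},
           {2, 4}})"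
  using triangulation_VIc triangulation_VIIb triangulation_VIIIa triangulation_IXa triangulation_Xa
  by (intro conjI)

end
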